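(* Let $G$ be a finite supersolvable group all of whose Sylow subgroups are elementary abelian. Then the coset lattice $\hat{\mathfrak{C}}(G)$ is co$EL$-shellable (i.e. it admits a co$EL$-labeling with integer labels), and so $G$ is coset-shellable (i.e. the coset poset $\mathfrak{C}(G)$ is shellable).
   Context: All posets and groups are finite. The coset poset $\mathfrak{C}(G)$ is the set of all cosets $Hx$ ($x\in G$) of proper subgroups $H\subsetneq G$, ordered by inclusion; the coset lattice is $\hat{\mathfrak{C}}(G)=\mathfrak{C}(G)\cup\{G,\emptyset\}$, ordered by inclusion. A group is supersolvable if it has a chief series in which every factor has prime order. Let $P$ be a bounded poset (one having a unique top and a unique bottom element). A cover relation is a pair $x<y$ in $P$ with no $z$ satisfying $x<z<y$. A labeling $\lambda$ of the cover relations of $P$ by integers is an $EL$-labeling if for every interval $[x,y]$ of $P$: (i) there is a unique maximal chain of $[x,y]$ whose sequence of labels, read from $x$ up to $y$, is strictly increasing; and (ii) this chain is first among the maximal chains of $[x,y]$ with respect to the lexicographic ordering of their label sequences. A co$EL$-labeling of $P$ is an $EL$-labeling of the dual poset of $P$ (so label sequences are read from top to bottom). The order complex $|P|$ of a poset $P$ is the simplicial complex with vertex set $P$ whose faces are the chains of $P$ (including the empty chain). A poset $P$ is shellable if the facets (maximal faces) of $|P|$ can be ordered $F_1,\dots,F_n$ so that for every $k\ge 2$ the complex $F_k\cap\bigl(\bigcup_{i=1}^{k-1}F_i\bigr)$ is a nonempty union of facets (codimension-one faces) of $F_k$; here each $F_i$ is identified with the simplex consisting of all its faces, and the empty set counts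 as a face (so it is the unique facet of a single vertex). The complex is not assumed pure. *)

theory Defs
  imports "HOL-Algebra.Sylow" "HOL-Algebra.Lattice"
begin

section \<open>Groups\<close>

text \<open>A chief series is an unrefinable series
  \<open>{\<one>} = N\<^sub>0 \<subset> N\<^sub>1 \<subset> \<dots> \<subset> N\<^sub>r = G\<close> of normal subgroups of \<open>G\<close>.\<close>

definition chief_series :: "('a, 'b) monoid_scheme \<Rightarrow> 'a set list \<Rightarrow> bool" where
  "chief_series G Ns \<longleftrightarrow>
     Ns \<noteq> [] \<and> hd Ns = {\<one>\<^bsub>G\<^esub>} \<and> last Ns = carrier G \<and>
     (\<forall>N\<in>set Ns. N \<lhd> G) \<and>
     (\<forall>i. Suc i < length Ns \<longrightarrow>
        Ns ! i \<subset> Ns ! Suc i \<and>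
        \<not> (\<exists>M. M \<lhd> G \<and> Ns ! i \<subset> M \<and> M \<subset> Ns ! Suc i))"

definition supersolvable :: "('a, 'b) monoid_scheme \<Rightarrow> bool" where
  "supersolvable G \<longleftrightarrow>
     (\<exists>Ns. chief_series G Ns \<and>
        (\<forall>i. Suc i < length Ns \<longrightarrow>
           prime (order ((G\<lparr>carrier := Ns ! Suc i\<rparr>) Mod (Ns ! i)))))"

text \<open>A prime not dividing the group order is allowed; its Sylow subgroup is trivial.\<close>

definition sylow_subgroup :: "nat \<Rightarrow> 'a set \<Rightarrow> ('a, 'b) monoid_scheme \<Rightarrow> bool" where
  "sylow_subgroup p H G \<longleftrightarrow>
     prime p \<and> subgroup H G \<and> card H = p ^ multiplicity p (order G)"

text \<open>Intended for prime \<open>p\<close>; the trivial group counts as elementary abelian.\<close>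

definition elementary_abelian :: "nat \<Rightarrow> ('a, 'b) monoid_scheme \<Rightarrow> bool" where
  "elementary_abelian p E \<longleftrightarrow>
     comm_group E \<and> (\<forall>x\<in>carrier E. x [^]\<^bsub>E\<^esub> p = \<one>\<^bsub>E\<^esub>)"


section \<open>Posets and shellability\<close>

locale finite_bounded_poset =
  partial_order L + weak_partial_order_bottom L + weak_partial_order_top L
  for L (structure) +
  assumes finite_carrier: "finite (carrier L)"

text \<open>A maximal chain, listed from its smallest to its largest element.\<close>

definition maximal_chain :: "('a, 'b) gorder_scheme \<Rightarrow> 'a list \<Rightarrow> bool" where
  "maximal_chain P xs \<longleftrightarrow>
     sorted_wrt (\<lambda>x y. x \<sqsubset>\<^bsub>P\<^esub> y) xs \<and> pred_on.maxchain (carrier P) (le P) (set xs)"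

definition chain_labels :: "('a \<Rightarrow> 'a \<Rightarrow> int) \<Rightarrow> 'a list \<Rightarrow> int list" where
  "chain_labels l xs = map2 l xs (tl xs)"

text \<open>
  Consecutive elements of a maximal chain of an interval \<open>[x, y]\<close> of \<open>P\<close> form a cover
  relation of \<open>P\<close>, so the total function \<open>l\<close> is only ever evaluated at pairs \<open>u, v\<close> such
  that \<open>v\<close> covers \<open>u\<close>; its other values are irrelevant.
  In the order \<open>lexord\<close>, a proper prefix precedes its extensions.
\<close>

definition EL_labeling :: "('a, 'b) gorder_scheme \<Rightarrow> ('a \<Rightarrow> 'a \<Rightarrow> int) \<Rightarrow> bool" where
  "EL_labeling P l \<longleftrightarrow>
     (\<forall>x\<in>carrier P. \<forall>y\<in>carrier P. x \<sqsubseteq>\<^bsub>P\<^esub> y \<longrightarrow>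
        (let I = P\<lparr>carrier := \<lbrace>x..y\<rbrace>\<^bsub>P\<^esub>\<rparr> in
         \<exists>c. maximal_chain I c \<and> sorted_wrt (<) (chain_labels l c) \<and>
             (\<forall>d. maximal_chain I d \<and> sorted_wrt (<) (chain_labels l d) \<longrightarrow> d = c) \<and>
             (\<forall>d. maximal_chain I d \<and> d \<noteq> c \<longrightarrow>
                (chain_labels l c, chain_labels l d) \<in> lexord {(a, b). a < b})))"

text \<open>The label of a cover \<open>u \<sqsubset> v\<close> of \<open>P\<close> is written \<open>l v u\<close> here, as it is
  the label of a cover relation of the dual poset.\<close>

definition coEL_labeling :: "('a, 'b) gorder_scheme \<Rightarrow> ('a \<Rightarrow> 'a \<Rightarrow> int) \<Rightarrow> bool" where
  "coEL_labeling P l \<longleftrightarrow> EL_labeling (inv_gorder P) l"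

definition coEL_shellable :: "('a, 'b) gorder_scheme \<Rightarrow> bool" where
  "coEL_shellable P \<longleftrightarrow> finite_bounded_poset P \<and> (\<exists>l. coEL_labeling P l)"

text \<open>A simplicial complex is represented by its set of faces, including the empty face.\<close>

definition order_complex :: "('a, 'b) gorder_scheme \<Rightarrow> 'a set set" where
  "order_complex P = {C. pred_on.chain (carrier P) (le P) C}"

definition facets :: "'a set set \<Rightarrow> 'a set set" where
  "facets K = {F\<in>K. \<not> (\<exists>F'\<in>K. F \<subset> F')}"

text \<open>The codimension-one faces of a simplex. The empty set is the only one of a vertex.\<close>

definition simplex_facets :: "'a set \<Rightarrow> 'a set set" where
  "simplex_facets F = {E. E \<subseteq> F \<and> card F = Suc (card E)}"

text \<open>Nonpure shellability. A face \<open>F\<close> is identified with the simplex \<open>Pow F\<close>; facets are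
  numbered from \<open>0\<close>.\<close>

definition shelling :: "'a set set \<Rightarrow> 'a set list \<Rightarrow> bool" where
  "shelling K Fs \<longleftrightarrow>
     distinct Fs \<and> set Fs = facets K \<and>
     (\<forall>k. 1 \<le> k \<and> k < length Fs \<longrightarrow>
        (\<exists>S. S \<noteq> {} \<and> S \<subseteq> simplex_facets (Fs ! k) \<and>
             Pow (Fs ! k) \<inter> (\<Union>i<k. Pow (Fs ! i)) = (\<Union>E\<in>S. Pow E)))"

definition shellable :: "('a, 'b) gorder_scheme \<Rightarrow> bool" where
  "shellable P \<longleftrightarrow> (\<exists>Fs. shelling (order_complex P) Fs)"


section \<open>The coset poset and the coset lattice\<close>

abbreviation inclusion_order :: "'a set set \<Rightarrow> 'a set gorder" where
  "inclusion_order A \<equiv> \<lparr>carrier = A, eq = (=), le = (\<subseteq>)\<rparr>"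

definition proper_cosets :: "('a, 'b) monoid_scheme \<Rightarrow> 'a set set" where
  "proper_cosets G =
     {H #>\<^bsub>G\<^esub> x | H x. subgroup H G \<and> H \<subset> carrier G \<and> x \<in> carrier G}"

definition coset_poset :: "('a, 'b) monoid_scheme \<Rightarrow> 'a set gorder" where
  "coset_poset G = inclusion_order (proper_cosets G)"

definition coset_lattice :: "('a, 'b) monoid_scheme \<Rightarrow> 'a set gorder" where
  "coset_lattice G = inclusion_order (proper_cosets G \<union> {carrier G, {}})"

definition coset_shellable :: "('a, 'b) monoid_scheme \<Rightarrow> bool" where
  "coset_shellable G \<longleftrightarrow> shellable (coset_poset G)"

end

theory Submission
  imports Defs "HOL-Library.List_Lexorder" "HOL-Algebra.Left_Coset" "HOL-Algebra.Zassenhaus"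
    "HOL-Algebra.Multiplicative_Group"
begin

text \<open>
  Let \<open>N 0 \<subset> \<dots> \<subset> N r\<close> be a chief series of \<open>G\<close>. As the Sylow subgroups are elementary abelian,
  Gaschuetz's theorem gives for every \<open>i\<close> a subgroup \<open>A i \<supseteq> N i\<close> that complements the factor
  \<open>N (i+1) / N i\<close>. A cover \<open>X \<supset> Y\<close> of nonempty cosets removes exactly one factor \<open>i\<close>. It is called
  special if \<open>Y = X \<inter> A i\<close>; special covers get the label \<open>- i - 1\<close>, other covers of nonempty cosets
  \<open>r - i\<close>, and covers of \<open>\<emptyset>\<close> the label \<open>0\<close>. Reading downwards from \<open>X\<close> to \<open>Y\<close>, the ascending chain is
  the greedy one: it first intersects with the \<open>A i\<close> containing \<open>Y\<close>, in decreasing order of \<open>i\<close>, and then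
  continues through the products of \<open>Y\<close> with the terms of the series. That the ascending chains are
  exactly the greedy ones is a statement about chains of length two, from which both the lexicographic
  property and the shelling follow.
\<close>

section \<open>Greedy labelings of finite posets\<close>

text \<open>The labels are chosen so that the smallest label in an interval has a closed form,
  \<open>min_label\<close>, in two sets: the factors \<open>D\<close> still to be removed and the
  subset \<open>S\<close> of those removable by a special cover. Descending to a nonempty lower
  cover deletes one index from \<open>D\<close> and \<open>S\<close>, so the statement on chains of
  length two becomes arithmetic with maxima. The constants form three blocks: special labels are
  negative, a cover of \<open>\<emptyset>\<close> has \<open>0\<close>, all others lie between
  \<open>1\<close> and \<open>r\<close>; within a block larger factors come first. They come first
  because for the largest factor \<open>i\<close> of \<open>H\<close> missing in \<open>K\<close>
  the product \<open>(H \<inter> N i) K\<close> is the only subgroup between \<open>K\<close> and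
  \<open>H\<close> that lacks just \<open>i\<close>; for a smaller \<open>i\<close> there can be
  several. The value \<open>0\<close> fits since \<open>\<emptyset>\<close> lies in every
  \<open>A i\<close>: towards \<open>\<emptyset>\<close> every factor can be removed specially, and
  a nonspecial cover followed by the step to \<open>\<emptyset>\<close> is a descent. The order used
  below is reverse inclusion, so that lists run downwards and an EL-labeling of it is a
  coEL-labeling of the lattice.\<close>

locale finite_poset = ordering less_eq less
  for less_eq :: "'a \<Rightarrow> 'a \<Rightarrow> bool" (infix \<open>\<^bold>\<le>\<close> 50)
    and less :: "'a \<Rightarrow> 'a \<Rightarrow> bool" (infix \<open>\<^bold><\<close> 50) +
  fixes L :: "'a set"
  assumes finite_L: "finite L"
begin

abbreviation poset :: "'a set \<Rightarrow> 'a gorder" where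
  "poset A \<equiv> \<lparr>carrier = A, eq = (=), le = less_eq\<rparr>"

definition covers :: "'a \<Rightarrow> 'a \<Rightarrow> bool" where
  "covers x y \<longleftrightarrow> x \<in> L \<and> y \<in> L \<and> x \<^bold>< y \<and> \<not> (\<exists>z\<in>L. x \<^bold>< z \<and> z \<^bold>< y)"

text \<open>Lists allow induction from the front, which the set-theoretic maximal chains do not;
  \<open>path_iff_maxchain\<close> identifies the two notions. The condition on \<open>set c\<close>
  matters for lists of length one.\<close>

definition path :: "'a \<Rightarrow> 'a \<Rightarrow> 'a list \<Rightarrow> bool" where
  "path x y c \<longleftrightarrow>
     c \<noteq> [] \<and> hd c = x \<and> last c = y \<and> set c \<subseteq> L \<and> successively covers c"

text \<open>The atom of \<open>[x, y]\<close> with the smallest label. Strictness makes it unique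
  and lets the first divergence of two paths decide their lexicographic order.\<close>

definition first_cover :: "('a \<Rightarrow> 'a \<Rightarrow> int) \<Rightarrow> 'a \<Rightarrow> 'a \<Rightarrow> 'a \<Rightarrow> bool" where
  "first_cover l x y z \<longleftrightarrow>
     covers x z \<and> z \<^bold>\<le> y \<and> (\<forall>w. covers x w \<and> w \<^bold>\<le> y \<and> w \<noteq> z \<longrightarrow> l x z < l x w)"

lemma covers_less: "covers x y \<Longrightarrow> x \<^bold>< y"
  by (simp add: covers_def)

lemma path_singleton [simp]: "path x y [z] \<longleftrightarrow> x = z \<and> y = z \<and> z \<in> L"
  by (auto simp: path_def)

lemma path_Cons [simp]:
  "path x y (u # v # c) \<longleftrightarrow> x = u \<and> covers u v \<and> path v y (v # c)"
  by (auto simp: path_def covers_def)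

lemma path_hd: "path x y c \<Longrightarrow> \<exists>c'. c = x # c'"
  by (cases c) (auto simp: path_def)

lemma path_append:
  "path x y (ps @ u # qs) \<longleftrightarrow> path x u (ps @ [u]) \<and> path u y (u # qs)"
  by (auto simp: path_def successively_append_iff hd_append)

lemma path_sorted: "path x y c \<Longrightarrow> sorted_wrt (\<^bold><) c"
proof -
  assume "path x y c"
  then have "successively (\<^bold><) c"
    by (auto simp: path_def elim!: successively_mono intro: covers_less)
  moreover have "transp (\<^bold><)"
    by (auto intro: transpI strict_trans)
  ultimately show ?thesis
    by (simp add: successively_conv_sorted_wrt)
qed

lemma sorted_distinct: "sorted_wrt (\<^bold><) c \<Longrightarrow> distinct c"
  by (induction c) (auto simp: irrefl)

lemma sorted_unique:
  assumes "sorted_wrt (\<^bold><) c" "sorted_wrt (\<^bold><) d" "set c = set d"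
  shows "c = d"
  using assms
proof (induction c arbitrary: d)
  case (Cons u c)
  then obtain v d' where d: "d = v # d'"
    by (cases d) auto
  have "u = v"
    using Cons.prems asym unfolding d by (metis insert_iff list.simps(15) sorted_wrt.simps(2))
  moreover have "set c = set d'"
    using Cons.prems sorted_distinct \<open>u = v\<close> unfolding d
    by (metis distinct.simps(2) insert_ident list.simps(15))
  ultimately show ?case
    using Cons unfolding d by auto
qed auto

lemma path_distinct: "path x y c \<Longrightarrow> distinct c"
  by (simp add: path_sorted sorted_distinct)

lemma path_ge: "path x y c \<Longrightarrow> z \<in> set c \<Longrightarrow> x \<^bold>\<le> z"
  using path_sorted[of x y c] by (cases c) (auto simp: path_def refl dest: strict_implies_order)

lemma path_le: "path x y c \<Longrightarrow> z \<in> set c \<Longrightarrow> z \<^bold>\<le> y"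
  using path_sorted[of x y c]
  by (cases c rule: rev_cases) (auto simp: path_def refl sorted_wrt_append dest: strict_implies_order)

lemma path_le_ends: "path x y c \<Longrightarrow> x \<^bold>\<le> y"
  by (metis path_def path_ge last_in_set)

lemma path_mem: "path x y c \<Longrightarrow> x \<in> set c \<and> y \<in> set c \<and> x \<in> L \<and> y \<in> L"
  by (auto simp: path_def)

lemma path_refl: "path x x c \<longleftrightarrow> c = [x] \<and> x \<in> L"
proof
  assume *: "path x x c"
  have "z = x" if "z \<in> set c" for z
    using path_ge[OF * that] path_le[OF * that] by (simp add: antisym)
  with path_distinct[OF *] have "length c \<le> 1"
    by (metis distinct_card subsetI singletonI card_mono finite.emptyI finite.insertI
        is_singletonI is_singleton_altdef)
  with * show "c = [x] \<and> x \<in> L"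
    by (cases c) (auto simp: path_def)
qed auto

text \<open>Follow \<open>c\<close> to its last element below \<open>z\<close>. The next element is
  strictly above \<open>z\<close>, and a cover leaves no room in between, so \<open>z\<close> is the
  element reached.\<close>

lemma path_saturated:
  assumes "path x y c" "z \<in> L" "\<And>u. u \<in> set c \<Longrightarrow> z \<^bold>\<le> u \<or> u \<^bold>\<le> z" "x \<^bold>\<le> z" "z \<^bold>\<le> y"
  shows "z \<in> set c"
  using assms
proof (induction c arbitrary: x)
  case Nil
  then show ?case by (simp add: path_def)
next
  case (Cons u c)
  show ?case
  proof (cases c)
    case Nil
    then show ?thesis using Cons.prems antisym by auto
  next
    case (Cons v c')
    have cov: "covers u v" and xu: "x = u" and p: "path v y c"
      using Cons.prems(1) Cons by auto
    show ?thesis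
    proof (cases "v \<^bold>\<le> z")
      case True
      then show ?thesis using Cons.IH[OF p] Cons.prems by auto
    next
      case False
      then have "z \<^bold>< v"
        using Cons.prems(3)[of v] Cons by (auto simp: strict_iff_order)
      then show ?thesis
        using cov xu Cons.prems(2,4) by (auto simp: covers_def order_iff_strict)
    qed
  qed
qed

lemma less_sorted:
  assumes "sorted_wrt (\<^bold><) (ps @ u # v # qs)" "w \<in> set (ps @ u # v # qs)"
  shows "w \<^bold>\<le> u \<or> v \<^bold>\<le> w"
  using assms by (auto simp: sorted_wrt_append order_iff_strict)

lemma chain_iff:
  "pred_on.chain A less_eq C \<longleftrightarrow> C \<subseteq> A \<and> (\<forall>u\<in>C. \<forall>v\<in>C. u \<^bold>\<le> v \<or> v \<^bold>\<le> u)"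
proof -
  have "(\<^bold>\<le>)\<^sup>=\<^sup>= = (\<^bold>\<le>)"
    by (auto simp: fun_eq_iff refl)
  then show ?thesis by (simp add: pred_on.chain_def)
qed

text \<open>Paths are maximal by \<open>path_saturated\<close>. Conversely, an element strictly
  between two consecutive entries would be comparable to the whole chain, so maximality would make
  it an entry.\<close>

lemma path_iff_maxchain:
  assumes xy: "x \<in> L" "y \<in> L" "x \<^bold>\<le> y"
  shows "path x y c \<longleftrightarrow>
    sorted_wrt (\<^bold><) c \<and> pred_on.maxchain {z\<in>L. x \<^bold>\<le> z \<and> z \<^bold>\<le> y} less_eq (set c)"
    (is "_ \<longleftrightarrow> _ \<and> pred_on.maxchain ?I _ _")
proof (intro iffI conjI)
  assume p: "path x y c"
  show sorted: "sorted_wrt (\<^bold><) c" using p by (rule path_sorted)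
  have comparable: "u \<^bold>\<le> v \<or> v \<^bold>\<le> u" if "u \<in> set c" "v \<in> set c" for u v
    using sorted that
    by (induction c) (auto simp: refl dest: strict_implies_order)
  have sub: "set c \<subseteq> ?I"
    using p path_ge[OF p] path_le[OF p] by (auto simp: path_def)
  have "z \<in> set c" if S: "pred_on.chain ?I less_eq S" "set c \<subseteq> S" "z \<in> S" for S z
  proof (rule path_saturated[OF p])
    show "z \<^bold>\<le> u \<or> u \<^bold>\<le> z" if "u \<in> set c" for u
      using S that unfolding chain_iff by blast
  qed (use S in \<open>auto simp: chain_iff\<close>)
  moreover have "pred_on.chain ?I less_eq (set c)"
    using sub comparable unfolding chain_iff by blast
  ultimately show "pred_on.maxchain ?I less_eq (set c)"
    unfolding pred_on.maxchain_def by blast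
next
  assume *: "sorted_wrt (\<^bold><) c \<and> pred_on.maxchain ?I less_eq (set c)"
  then have sorted: "sorted_wrt (\<^bold><) c" and chain: "pred_on.chain ?I less_eq (set c)"
    by (simp_all add: pred_on.maxchain_def)
  then have sub: "set c \<subseteq> ?I"
    and comparable: "\<And>u v. u \<in> set c \<Longrightarrow> v \<in> set c \<Longrightarrow> u \<^bold>\<le> v \<or> v \<^bold>\<le> u"
    unfolding chain_iff by blast+
  have max: "z \<in> set c" if "z \<in> ?I" "\<And>u. u \<in> set c \<Longrightarrow> u \<^bold>\<le> z \<or> z \<^bold>\<le> u" for z
  proof (rule ccontr)
    assume "z \<notin> set c"
    moreover have "pred_on.chain ?I less_eq (insert z (set c))"
      using that sub comparable refl unfolding chain_iff by blast
    ultimately show False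
      using * by (auto simp: pred_on.maxchain_def)
  qed
  have x: "x \<in> set c" and y: "y \<in> set c"
    using sub xy refl by (blast intro: max)+
  have hd: "hd c = x"
    using sorted x sub by (cases c) (auto simp: strict_iff_order intro: antisym)
  have last: "last c = y"
    using sorted y sub by (cases c rule: rev_cases)
      (auto simp: strict_iff_order sorted_wrt_append intro: antisym)
  have "covers u v" if c: "c = ps @ u # v # qs" for ps u v qs
  proof -
    have "\<not> (u \<^bold>< z \<and> z \<^bold>< v)" if "z \<in> L" for z
    proof
      assume z: "u \<^bold>< z \<and> z \<^bold>< v"
      have comp: "w \<^bold>\<le> u \<or> v \<^bold>\<le> w" if "w \<in> set c" for w
        using less_sorted sorted that unfolding c by blast
      have "z \<in> set c"
      proof (rule max)
        show "w \<^bold>\<le> z \<or> z \<^bold>\<le> w" if "w \<in> set c" for w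
          using comp[OF that] z by (meson strict_implies_order trans)
        show "z \<in> ?I"
          using sub z \<open>z \<in> L\<close> trans[of x u z] trans[of z v y]
          by (auto simp: c strict_implies_order)
      qed
      then show False
        using comp z asym by (meson strict_trans1 strict_trans2 irrefl)
    qed
    then show ?thesis
      using sorted sub unfolding c by (auto simp: covers_def sorted_wrt_append)
  qed
  moreover have "c = take i c @ c ! i # c ! Suc i # drop (Suc (Suc i)) c" if "Suc i < length c" for i
    using that by (simp add: Cons_nth_drop_Suc)
  ultimately have "successively covers c"
    unfolding successively_conv_nth by blast
  then show "path x y c"
    using x hd last sub by (auto simp: path_def)
qed

lemma maximal_chain_iff_path:
  assumes "x \<in> L" "y \<in> L" "x \<^bold>\<le> y"
  shows "maximal_chain (poset \<lbrace>x..y\<rbrace>\<^bsub>poset L\<^esub>) c \<longleftrightarrow> path x y c"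
proof -
  have "\<lbrace>x..y\<rbrace>\<^bsub>poset L\<^esub> = {z\<in>L. x \<^bold>\<le> z \<and> z \<^bold>\<le> y}"
    by (auto simp: at_least_at_most_def)
  moreover have "(\<lambda>u v. u \<sqsubset>\<^bsub>poset A\<^esub> v) = (\<^bold><)" for A
    by (auto simp: lless_def fun_eq_iff strict_iff_order)
  ultimately show ?thesis
    by (simp add: maximal_chain_def path_iff_maxchain[OF assms])
qed

lemma sorted_list_of_chain:
  assumes "finite C" "\<And>u v. u \<in> C \<Longrightarrow> v \<in> C \<Longrightarrow> u \<^bold>\<le> v \<or> v \<^bold>\<le> u"
  shows "\<exists>c. sorted_wrt (\<^bold><) c \<and> set c = C"
  using assms
proof (induction C rule: finite_psubset_induct)
  case (psubset C)
  show ?case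
  proof (cases "C = {}")
    case False
    obtain m where m: "m \<in> C" "\<And>x. x \<in> C \<Longrightarrow> \<not> x \<^bold>< m"
      using Finite_Set.bex_min_element[of C "(\<^bold><)"] psubset.hyps False irrefl
      by (metis (no_types, lifting) asymp_onI transp_onI asym strict_trans)
    have "C - {m} \<subset> C" using m by auto
    then obtain c where c: "sorted_wrt (\<^bold><) c" "set c = C - {m}"
      using psubset.IH[of "C - {m}"] psubset.prems by blast
    have "m \<^bold>< x" if "x \<in> C - {m}" for x
      using that m psubset.prems[of m x] by (auto simp: order_iff_strict)
    with c m show ?thesis by (intro exI[of _ "m # c"]) auto
  qed auto
qed

end

section \<open>Label sequences and greedy labelings\<close>

lemma chain_labels_simps [simp]:
  "chain_labels l [] = []" "chain_labels l [x] = []"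
  "chain_labels l (x # y # c) = l x y # chain_labels l (y # c)"
  by (simp_all add: chain_labels_def)

lemma chain_labels_append:
  "chain_labels l (ps @ x # c) = chain_labels l (ps @ [x]) @ chain_labels l (x # c)"
proof (induction ps)
  case (Cons a ps)
  then show ?case by (cases ps) auto
qed auto

lemma sorted_wrt_less_Cons2:
  "sorted_wrt (<) (a # b # (c :: 'a :: order list)) \<longleftrightarrow> a < b \<and> sorted_wrt (<) (b # c)"
  by (auto dest: less_trans)

lemma chain_labels_descent:
  assumes "\<not> sorted_wrt (<) (chain_labels l c)"
  shows "\<exists>ps u v w qs. c = ps @ u # v # w # qs \<and> \<not> l u v < l v w"
  using assms
proof (induction c)
  case (Cons u c)
  show ?case
  proof (cases "\<exists>v w qs. c = v # w # qs \<and> \<not> l u v < l v w")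
    case True
    then show ?thesis by (metis append_Nil)
  next
    case False
    with Cons.prems have "\<not> sorted_wrt (<) (chain_labels l c)"
      by (cases c; cases "tl c") (auto simp: sorted_wrt_less_Cons2 simp del: sorted_wrt.simps(2), simp)
    with Cons.IH show ?thesis by (metis append_Cons)
  qed
qed auto


text \<open>The second assumption is the statement on chains of length two. Read from left to right
  it makes the greedy path ascending and supplies the detours of the shelling; read from right to
  left it makes every ascending path greedy.\<close>

locale greedy_labeling = finite_poset +
  fixes l :: "'a \<Rightarrow> 'a \<Rightarrow> int"
  assumes first_cover_exists: "x \<in> L \<Longrightarrow> y \<in> L \<Longrightarrow> x \<^bold>< y \<Longrightarrow> \<exists>z. first_cover l x y z"
    and first_cover_iff_ascent:
      "y \<in> L \<Longrightarrow> z \<^bold>< y \<Longrightarrow> covers x z \<Longrightarrow> first_cover l z y w \<Longrightarrow>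
        first_cover l x y z \<longleftrightarrow> l x z < l z w"
begin

abbreviation ascending :: "'a list \<Rightarrow> bool" where
  "ascending c \<equiv> sorted_wrt (<) (chain_labels l c)"

lemma first_cover_covers: "first_cover l x y z \<Longrightarrow> covers x z"
  and first_cover_le: "first_cover l x y z \<Longrightarrow> z \<^bold>\<le> y"
  and first_cover_less: "first_cover l x y z \<Longrightarrow> covers x w \<Longrightarrow> w \<^bold>\<le> y \<Longrightarrow> w \<noteq> z \<Longrightarrow> l x z < l x w"
  by (auto simp: first_cover_def)

text \<open>Greedy construction by induction on the number of elements above \<open>x\<close>. The
  clause on \<open>c ! 1\<close> carries the induction: the label following the one of
  \<open>x\<close> and \<open>z\<close> belongs to the first cover of \<open>[z, y]\<close>, as the
  ascent criterion demands.\<close>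

lemma ascending_path_exists:
  assumes "x \<in> L" "y \<in> L" "x \<^bold>\<le> y"
  shows "\<exists>c. path x y c \<and> ascending c \<and> (x \<noteq> y \<longrightarrow> first_cover l x y (c ! 1))"
  using assms
proof (induction "card {u\<in>L. x \<^bold>< u}" arbitrary: x rule: less_induct)
  case less
  show ?case
  proof (cases "x = y")
    case True
    then show ?thesis using less.prems by (intro exI[of _ "[x]"]) auto
  next
    case False
    then have "x \<^bold>< y"
      using less.prems by (simp add: order_iff_strict)
    then obtain z where z: "first_cover l x y z"
      using less.prems first_cover_exists by blast
    then have cov: "covers x z" and zy: "z \<^bold>\<le> y"
      by (auto simp: first_cover_covers first_cover_le)
    have "card {u\<in>L. z \<^bold>< u} < card {u\<in>L. x \<^bold>< u}"
    proof (rule psubset_card_mono)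
      show "{u\<in>L. z \<^bold>< u} \<subset> {u\<in>L. x \<^bold>< u}"
        using cov strict_trans[of x z] irrefl[of z] unfolding covers_def by blast
    qed (use finite_L in auto)
    from less.hyps[OF this] cov zy less.prems
    obtain c where c: "path z y c" "ascending c" "z \<noteq> y \<Longrightarrow> first_cover l z y (c ! 1)"
      by (auto simp: covers_def)
    from c(1) obtain c' where c': "c = z # c'"
      using path_hd by blast
    have "ascending (x # c)"
    proof (cases c')
      case (Cons w ws)
      then have "z \<^bold>< y"
        using c(1) unfolding c' by (metis path_Cons covers_less path_le_ends strict_trans1 strict_trans2)
      then have "l x z < l z w"
        using first_cover_iff_ascent[OF less.prems(2) _ cov, of w] c(3) z irrefl
        by (auto simp: c' Cons)
      then show ?thesis
        using c(2) unfolding c' Cons by (simp add: sorted_wrt_less_Cons2 del: sorted_wrt.simps)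
    qed (simp add: c')
    then show ?thesis
      using c(1) cov z c' by (intro exI[of _ "x # c"]) auto
  qed
qed

text \<open>The argument runs from the end: a single cover is the only atom of its interval, and
  each ascent passes greediness on to the preceding step.\<close>

lemma ascending_first_cover:
  assumes "path x y (x # z # c)" "ascending (x # z # c)"
  shows "first_cover l x y z"
  using assms
proof (induction c arbitrary: x z)
  case Nil
  then have "covers x y" "z = y" by auto
  then show ?case
    unfolding first_cover_def by (auto simp: covers_def refl order_iff_strict)
next
  case (Cons w c)
  then have p: "path z y (z # w # c)" and cov: "covers x z"
    and "l x z < l z w" "ascending (z # w # c)"
    by (auto simp: sorted_wrt_less_Cons2 simp del: sorted_wrt.simps)
  moreover have "z \<^bold>< y"
    using p by (metis path_Cons covers_less path_le_ends strict_trans2)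
  ultimately show ?case
    using first_cover_iff_ascent[OF _ _ cov] Cons.IH[OF p] path_mem[OF p] by blast
qed

text \<open>Where \<open>d\<close> leaves \<open>c\<close>, the ascending path takes the first
  cover, so the labels differ there in favour of \<open>c\<close>.\<close>

lemma ascending_path_lexord:
  assumes "path x y c" "path x y d" "ascending c" "d \<noteq> c"
  shows "chain_labels l c < chain_labels l d"
  using assms
proof (induction c arbitrary: x d)
  case Nil
  then show ?case by (simp add: path_def)
next
  case (Cons u c)
  then have u: "u = x" by (simp add: path_def)
  show ?case
  proof (cases c)
    case Nil
    then show ?thesis using Cons.prems u by (auto simp: path_refl)
  next
    case (Cons z c')
    then have p: "path z y c" and cov: "covers x z"
      using Cons.prems u by auto
    have "x \<noteq> y"
      using p cov by (metis covers_less path_le_ends strict_trans2 irrefl)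
    then obtain w d' where d: "d = x # w # d'"
      using Cons.prems(2) by (cases d; cases "tl d") (auto simp: path_def)
    then have q: "path w y (w # d')" "covers x w"
      using Cons.prems(2) by auto
    show ?thesis
    proof (cases "w = z")
      case True
      then show ?thesis
        using Cons.IH[OF p] q Cons.prems u Cons d by auto
    next
      case False
      have "first_cover l x y z"
        using Cons.prems Cons u by (intro ascending_first_cover) auto
      then have "l x z < l x w"
        using False q path_le_ends by (intro first_cover_less) auto
      then show ?thesis using Cons u d by simp
    qed
  qed
qed

theorem EL_labeling_greedy: "EL_labeling (poset L) l"
proof -
  have "\<exists>c. path x y c \<and> ascending c \<and> (\<forall>d. path x y d \<and> ascending d \<longrightarrow> d = c) \<and>
      (\<forall>d. path x y d \<and> d \<noteq> c \<longrightarrow> (chain_labels l c, chain_labels l d) \<in> lexord {(a, b). a < b})"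
    if xy: "x \<in> L" "y \<in> L" "x \<^bold>\<le> y" for x y
  proof -
    obtain c where c: "path x y c" "ascending c"
      using ascending_path_exists[OF xy] by blast
    \<comment> \<open>Uniqueness is part of the lexicographic property: of two distinct ascending
      paths each would precede the other.\<close>
    then show ?thesis
      using ascending_path_lexord[of x y] unfolding list_less_def[symmetric]
      by (metis less_asym)
  qed
  then show ?thesis
    by (auto simp: EL_labeling_def Let_def maximal_chain_iff_path)
qed

text \<open>Exchange step of the shelling: at a non-ascent of \<open>c\<close> before its first return to \<open>d\<close>,
  the middle element can be traded for a lexicographically smaller detour.\<close>

lemma exchange:
  assumes c: "path x y c" and d: "path x y d" and "c \<noteq> d"
    and le: "chain_labels l d \<le> chain_labels l c"
  shows "\<exists>z e. z \<in> set c \<and> z \<notin> set d \<and> path x y e \<and> set c - {z} \<subseteq> set e \<and>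
    chain_labels l e < chain_labels l c"
proof -
  obtain rs c' d' where cd: "c = rs @ c'" "d = rs @ d'"
    and diff: "c' = [] \<or> d' = [] \<or> hd c' \<noteq> hd d'"
    using longest_common_prefix[of c d] by (elim exE conjE) (rule that)
  have last: "last c = y" "last d = y" and distinct: "distinct c" "distinct d"
    and hd: "hd c = x" "hd d = x" and ne: "c \<noteq> []" "d \<noteq> []"
    using c d path_distinct[OF c] path_distinct[OF d] by (simp_all add: path_def)
  \<comment> \<open>Neither path can extend the other: both end in \<open>y\<close>, and
    \<open>y\<close> occurs only once in each.\<close>
  have no_prefix: False if "ys = xs @ zs" "xs \<noteq> ys" "last xs = last ys" "xs \<noteq> []" "distinct ys"
    for xs ys zs :: "'a list"
  proof -
    have "zs \<noteq> []" using that by auto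
    then have "last ys \<in> set zs" using that by simp
    moreover have "last ys \<in> set xs" using that(3,4) by (metis last_in_set)
    ultimately show False using that(1,5) by auto
  qed
  have "c' \<noteq> []" "d' \<noteq> []"
    using no_prefix[of d c d'] no_prefix[of c d c'] last distinct ne \<open>c \<noteq> d\<close> cd by auto
  with diff obtain c1 cs d1 ds where c': "c' = c1 # cs" and d': "d' = d1 # ds" and "c1 \<noteq> d1"
    by (cases c'; cases d') auto
  have "rs \<noteq> []"
    using hd \<open>c1 \<noteq> d1\<close> unfolding cd c' d' by (cases rs) auto
  then obtain ps u where rs: "rs = ps @ [u]"
    by (cases rs rule: rev_cases) auto
  have c_eq: "c = ps @ u # c1 # cs" and d_eq: "d = ps @ u # d1 # ds"
    by (simp_all add: cd rs c' d')
  have pc: "path u y (u # c1 # cs)" and pd: "path u y (u # d1 # ds)"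
    and px: "path x u (ps @ [u])"
    using c d path_append[of x y ps u "c1 # cs"] path_append[of x y ps u "d1 # ds"]
    unfolding c_eq d_eq by simp_all
  have "y \<in> set (c1 # cs) \<inter> set d"
    \<comment> \<open>\<open>v\<close> below is the first element after the divergence at which
      \<open>c\<close> meets \<open>d\<close> again, and \<open>ms\<close> is the stretch before it,
      which avoids \<open>d\<close>. Such a \<open>v\<close> exists because both paths end in
      \<open>y\<close>.\<close>
    using last_in_set[of "c1 # cs"] last_in_set[of d] last ne(2) by (simp add: c_eq)
  then obtain ms v qs where split: "c1 # cs = ms @ v # qs" "v \<in> set d" "\<forall>m\<in>set ms. m \<notin> set d"
  proof -
    have "\<exists>z\<in>set (c1 # cs). z \<in> set d"
      using \<open>y \<in> _\<close> by blast
    from split_list_first_prop[OF this] show thesis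
      by (elim exE conjE bexE) (rule that)
  qed
  have "v \<in> set (d1 # ds)"
  proof -
    have "v \<in> set (c1 # cs)" using split(1) by simp
    then have "v \<notin> set (ps @ [u])" using distinct(1) unfolding c_eq by auto
    then show ?thesis using split(2) unfolding d_eq by auto
  qed
  then have "d1 \<^bold>\<le> v"
    using pd path_ge[of d1 y] by auto
  \<comment> \<open>If \<open>c\<close> returned at once, \<open>c1\<close> would lie above
    \<open>d1\<close>, and comparable covers of \<open>u\<close> coincide.\<close>
  have "ms \<noteq> []"
  proof
    assume "ms = []"
    then have "covers u c1" "d1 \<^bold>\<le> c1" "covers u d1"
      using pc pd split \<open>d1 \<^bold>\<le> v\<close> by auto
    then show False
      using \<open>c1 \<noteq> d1\<close> by (auto simp: covers_def order_iff_strict)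
  qed
  with split obtain ms' where ms: "ms = c1 # ms'" and cs: "cs = ms' @ v # qs"
    by (cases ms) auto
  have pv: "path u v (u # c1 # ms' @ [v])"
    using pc path_append[of u y "u # c1 # ms'" v qs] unfolding cs by simp
  have c_split: "c = ps @ (u # c1 # ms' @ [v]) @ qs"
    by (simp add: c_eq cs)
  \<comment> \<open>Otherwise \<open>c1\<close> would be the first cover of \<open>[u, v]\<close>.
    As \<open>d1\<close> is another atom of that interval, \<open>c\<close> would precede
    \<open>d\<close>.\<close>
  have "\<not> ascending (u # c1 # ms' @ [v])"
  proof
    assume "ascending (u # c1 # ms' @ [v])"
    then have "first_cover l u v c1"
      using pv by (intro ascending_first_cover)
    then have "l u c1 < l u d1"
      using \<open>d1 \<^bold>\<le> v\<close> \<open>c1 \<noteq> d1\<close> pd first_cover_less[of u v c1 d1] by auto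
    then have "chain_labels l c < chain_labels l d"
      unfolding c_eq d_eq list_less_def
        chain_labels_append[of l ps u "c1 # cs"] chain_labels_append[of l ps u "d1 # ds"]
      by (intro lexord_append_leftI) simp
    with le show False by simp
  qed
  from chain_labels_descent[OF this] obtain ps' a z b qs' where
    descent: "u # c1 # ms' @ [v] = ps' @ a # z # b # qs'" "\<not> l a z < l z b"
    by (elim exE conjE) (rule that)
  \<comment> \<open>The middle of three consecutive entries is an inner element of the segment from
    \<open>u\<close> to \<open>v\<close>, hence off \<open>d\<close>.\<close>
  have "z \<in> set (c1 # ms')"
  proof -
    have "set (butlast (tl (u # c1 # ms' @ [v]))) = set (c1 # ms')"
      by (simp add: butlast_append)
    moreover have "z \<in> set (butlast (tl (ps' @ a # z # b # qs')))"
      by (cases ps') (auto simp: butlast_append)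
    ultimately show ?thesis unfolding descent by simp
  qed
  then have "z \<notin> set d" "z \<in> set c"
    using split(3) by (auto simp: ms c_split)
  define ps2 qs2 where "ps2 = ps @ ps'" and "qs2 = qs' @ qs"
  have c2: "c = ps2 @ a # z # b # qs2"
    by (simp add: c_split descent(1) ps2_def qs2_def)
  have "path x a (ps2 @ [a])" "path a y (a # z # b # qs2)"
    using c path_append[of x y ps2 a "z # b # qs2"] unfolding c2 by auto
  then have pa: "path x a (ps2 @ [a])" and cov: "covers a z" "covers z b"
    and pb: "path b y (b # qs2)"
    by auto
  then have mem: "a \<in> L" "b \<in> L" "a \<^bold>< b" "z \<^bold>< b"
    by (auto simp: covers_def intro: strict_trans)
  \<comment> \<open>\<open>[z, b]\<close> has a single atom, so the ascent criterion can be applied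
    to the non-ascent at \<open>z\<close>.\<close>
  have "first_cover l z b b"
    using cov(2) unfolding first_cover_def by (auto simp: covers_def refl order_iff_strict)
  then have "\<not> first_cover l a b z"
    using first_cover_iff_ascent[OF mem(2,4) cov(1)] descent(2) by blast
  \<comment> \<open>The detour: the ascending path of \<open>[a, b]\<close> starts with the first
    cover, whose label is smaller than that of \<open>z\<close>, and replaces the piece through
    \<open>z\<close>.\<close>
  obtain e where e: "path a b e" "first_cover l a b (e ! 1)"
    using ascending_path_exists[of a b] mem irrefl by (auto simp: order_iff_strict)
  have "l a (e ! 1) < l a z"
    using \<open>\<not> first_cover l a b z\<close> e(2) cov mem strict_implies_order
    by (intro first_cover_less[OF e(2)]) auto
  obtain w e' where e_eq: "e = a # w # e'"
    using e(1) mem irrefl by (cases e; cases "tl e") (auto simp: path_def)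
  have "b \<in> set e" using path_mem[OF e(1)] by simp
  then obtain e'' where e_eq': "e = e'' @ [b]"
    using e(1) by (cases e rule: rev_cases) (auto simp: path_def)
  define f where "f = ps2 @ e @ qs2"
  have "path a y (e @ qs2)"
    using e(1) pb path_append[of a y e'' b qs2] by (simp add: e_eq')
  then have "path x y f"
    using pa path_append[of x y ps2 a "w # e' @ qs2"] by (simp add: f_def e_eq)
  moreover have "set c - {z} \<subseteq> set f"
    using \<open>b \<in> set e\<close> by (auto simp: c2 f_def e_eq)
  moreover have "chain_labels l f < chain_labels l c"
    using \<open>l a (e ! 1) < l a z\<close>
    unfolding c2 f_def e_eq append_Cons list_less_def
      chain_labels_append[of l ps2 a "z # b # qs2"] chain_labels_append[of l ps2 a "w # e' @ qs2"]
    by (intro lexord_append_leftI) simp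
  ultimately show ?thesis
    using \<open>z \<notin> set d\<close> \<open>z \<in> set c\<close> by (intro exI[of _ z] exI[of _ f]) simp
qed

end

section \<open>Shelling the proper part of a bounded poset\<close>

locale bounded_greedy_labeling = greedy_labeling +
  fixes b t :: 'a
  assumes ends: "b \<in> L" "t \<in> L" "b \<noteq> t"
    and bounds: "x \<in> L \<Longrightarrow> b \<^bold>\<le> x" "x \<in> L \<Longrightarrow> x \<^bold>\<le> t"
begin

text \<open>The two ends are comparable to every element, so adding or deleting them carries chains
  to chains and preserves maximality.\<close>

lemma facets_proper_part:
  "facets (order_complex (poset (L - {b, t}))) = {set c - {b, t} | c. path b t c}"
    (is "facets ?K = _")
proof -
  have K_iff: "C \<in> ?K \<longleftrightarrow> C \<subseteq> L - {b, t} \<and> (\<forall>u\<in>C. \<forall>v\<in>C. u \<^bold>\<le> v \<or> v \<^bold>\<le> u)" for C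
    by (simp add: order_complex_def chain_iff)
  have chain_iff': "pred_on.chain {z\<in>L. b \<^bold>\<le> z \<and> z \<^bold>\<le> t} less_eq C \<longleftrightarrow>
      C \<subseteq> L \<and> (\<forall>u\<in>C. \<forall>v\<in>C. u \<^bold>\<le> v \<or> v \<^bold>\<le> u)" for C
    using bounds unfolding chain_iff by blast
  have bt: "b \<^bold>\<le> t" using bounds ends by auto
  note path_iff = path_iff_maxchain[OF ends(1,2) bt]
  have proper: "C - {b, t} \<in> ?K" if "pred_on.chain {z\<in>L. b \<^bold>\<le> z \<and> z \<^bold>\<le> t} less_eq C" for C
    using that unfolding K_iff chain_iff' by blast
  have full: "pred_on.chain {z\<in>L. b \<^bold>\<le> z \<and> z \<^bold>\<le> t} less_eq (C \<union> {b, t})" if "C \<in> ?K" for C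
    using that ends bounds unfolding K_iff chain_iff' by (auto simp: refl)
  have "\<exists>c. path b t c \<and> F = set c - {b, t}" if F: "F \<in> facets ?K" for F
  proof -
    from F have FK: "F \<in> ?K" by (simp add: facets_def)
    have max: "\<not> F \<union> {b, t} \<subset> S" if S: "pred_on.chain {z\<in>L. b \<^bold>\<le> z \<and> z \<^bold>\<le> t} less_eq S" for S
    proof
      assume "F \<union> {b, t} \<subset> S"
      moreover have "F \<subseteq> L - {b, t}" using FK K_iff by blast
      ultimately have "F \<subset> S - {b, t}" by blast
      then show False using F proper[OF S] by (auto simp: facets_def)
    qed
    have "finite (F \<union> {b, t})"
      using FK finite_L by (auto simp: K_iff intro: finite_subset)
    then obtain c where c: "sorted_wrt (\<^bold><) c" "set c = F \<union> {b, t}"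
      using sorted_list_of_chain full[OF FK] unfolding chain_iff' by metis
    then have "path b t c"
      using full[OF FK] max by (auto simp: path_iff pred_on.maxchain_def)
    moreover have "F = set c - {b, t}"
      using FK c(2) by (auto simp: K_iff)
    ultimately show ?thesis by blast
  qed
  moreover have "set c - {b, t} \<in> facets ?K" if c: "path b t c" for c
  proof -
    have chain: "pred_on.chain {z\<in>L. b \<^bold>\<le> z \<and> z \<^bold>\<le> t} less_eq (set c)"
      and max: "\<And>S. pred_on.chain {z\<in>L. b \<^bold>\<le> z \<and> z \<^bold>\<le> t} less_eq S \<Longrightarrow> \<not> set c \<subset> S"
      using c by (auto simp: path_iff pred_on.maxchain_def)
    have "\<not> set c - {b, t} \<subset> F'" if F': "F' \<in> ?K" for F'
    proof
      assume "set c - {b, t} \<subset> F'"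
      moreover have "F' \<subseteq> L - {b, t}" using F' K_iff by blast
      ultimately have "set c \<subset> F' \<union> {b, t}"
        using path_mem[OF c] by blast
      then show False using max[OF full[OF F']] by blast
    qed
    then show ?thesis
      using proper[OF chain] unfolding facets_def by blast
  qed
  ultimately show ?thesis by blast
qed

lemma path_eq_if_same_inner:
  assumes "path b t c" "path b t d" "set c - {b, t} = set d - {b, t}"
  shows "c = d"
proof -
  have "set c = set d"
    using assms path_mem by blast
  moreover have "sorted_wrt (\<^bold><) c" "sorted_wrt (\<^bold><) d"
    using assms path_sorted by auto
  ultimately show ?thesis
    using sorted_unique by blast
qed

text \<open>The facets are ordered by the label sequences of their paths. Ties may be broken
  arbitrarily, because \<open>exchange\<close> accepts equal sequences and returns a strictly
  smaller one, which must stand earlier in the list.\<close>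

theorem shellable_proper_part: "shellable (poset (L - {b, t}))"
proof -
  define Cs where "Cs = {c. path b t c}"
  have "Cs \<subseteq> {c. set c \<subseteq> L \<and> distinct c}"
    by (auto simp: Cs_def path_distinct path_def)
  then have "finite Cs"
    using finite_subset finite_subset_distinct[OF finite_L] by blast
  then obtain cs0 where "distinct cs0" "set cs0 = Cs"
    using finite_distinct_list by blast
  define cs where "cs = sort_key (chain_labels l) cs0"
  have cs: "distinct cs" "set cs = Cs" "sorted (map (chain_labels l) cs)"
    using \<open>distinct cs0\<close> \<open>set cs0 = Cs\<close> by (simp_all add: cs_def)
  define inner where "inner c = set c - {b, t}" for c
  define Fs where "Fs = map inner cs"
  have "inj_on inner Cs"
    by (auto simp: inj_on_def inner_def Cs_def intro: path_eq_if_same_inner)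
  then have "distinct Fs"
    using cs by (simp add: Fs_def distinct_map)
  moreover have "set Fs = facets (order_complex (poset (L - {b, t})))"
    using cs(2) by (auto simp: Fs_def facets_proper_part inner_def Cs_def)
  moreover have "\<exists>S. S \<noteq> {} \<and> S \<subseteq> simplex_facets (Fs ! k) \<and>
      Pow (Fs ! k) \<inter> (\<Union>i<k. Pow (Fs ! i)) = (\<Union>E\<in>S. Pow E)"
    if k: "1 \<le> k" "k < length Fs" for k
  proof -
    \<comment> \<open>It suffices that the intersection with any earlier facet lies in a
      codimension-one face that is itself contained in some earlier facet. \<open>exchange\<close>
      yields this face by deleting \<open>z\<close>.\<close>
    let ?S = "{E \<in> simplex_facets (Fs ! k). \<exists>i<k. E \<subseteq> Fs ! i}"
    have step: "\<exists>E\<in>?S. Fs ! i \<inter> Fs ! k \<subseteq> E" if i: "i < k" for i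
    proof -
      let ?c = "cs ! k" and ?d = "cs ! i"
      have lt: "k < length cs" "i < length cs" using k i by (auto simp: Fs_def)
      have c: "path b t ?c" and d: "path b t ?d"
        using cs(2) lt nth_mem unfolding Cs_def by blast+
      have "?c \<noteq> ?d" using cs(1) lt i by (auto simp: nth_eq_iff_index_eq)
      moreover have "chain_labels l ?d \<le> chain_labels l ?c"
        using sorted_nth_mono[OF cs(3), of i k] lt i by simp
      ultimately obtain z e where z: "z \<in> set ?c" "z \<notin> set ?d" and e: "path b t e"
        and sub: "set ?c - {z} \<subseteq> set e" and less: "chain_labels l e < chain_labels l ?c"
        using exchange[OF c d] by blast
      obtain j where j: "j < length cs" "cs ! j = e"
        using e cs(2) by (metis (mono_tags, lifting) Cs_def in_set_conv_nth mem_Collect_eq)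
      have "j < k"
        using sorted_nth_mono[OF cs(3), of k j] lt j less by (cases "j < k") auto
      have "z \<noteq> b" "z \<noteq> t" using z path_mem[OF d] by auto
      then have zF: "z \<in> Fs ! k" "z \<notin> Fs ! i"
        using z lt by (auto simp: Fs_def inner_def)
      moreover have "finite (Fs ! k)"
        using lt by (simp add: Fs_def inner_def)
      ultimately have "Fs ! k - {z} \<in> simplex_facets (Fs ! k)"
        unfolding simplex_facets_def using card.remove[of "Fs ! k" z] by blast
      moreover have "Fs ! k - {z} \<subseteq> Fs ! j"
        using sub lt j by (auto simp: Fs_def inner_def)
      ultimately have "Fs ! k - {z} \<in> ?S"
        using \<open>j < k\<close> by auto
      moreover have "Fs ! i \<inter> Fs ! k \<subseteq> Fs ! k - {z}"
        using zF(2) by auto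
      ultimately show ?thesis by (rule bexI[rotated])
    qed
    have "?S \<noteq> {}" using step[of 0] k(1) by (metis (no_types, lifting) empty_iff less_eq_Suc_le One_nat_def)
    moreover have "Pow (Fs ! k) \<inter> (\<Union>i<k. Pow (Fs ! i)) = (\<Union>E\<in>?S. Pow E)"
    proof (intro equalityI subsetI)
      fix E assume "E \<in> Pow (Fs ! k) \<inter> (\<Union>i<k. Pow (Fs ! i))"
      then obtain i where "i < k" "E \<subseteq> Fs ! i \<inter> Fs ! k" by auto
      with step[of i] show "E \<in> (\<Union>E\<in>?S. Pow E)" by blast
    next
      fix E assume "E \<in> (\<Union>E\<in>?S. Pow E)"
      then show "E \<in> Pow (Fs ! k) \<inter> (\<Union>i<k. Pow (Fs ! i))"
        by (fastforce simp: simplex_facets_def)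
    qed
    ultimately show ?thesis by (intro exI[of _ ?S]) auto
  qed
  ultimately have "shelling (order_complex (poset (L - {b, t}))) Fs"
    by (simp add: shelling_def)
  then show ?thesis by (auto simp: shellable_def)
qed

end

section \<open>Complements of abelian normal subgroups\<close>

lemma (in group) inv_cancel_left:
  assumes "x \<in> carrier G" "y \<in> carrier G"
  shows "inv x \<otimes> (x \<otimes> y) = y" "x \<otimes> (inv x \<otimes> y) = y"
  using assms by (simp_all flip: m_assoc)

lemma (in group) mem_set_mult:
  "x \<in> H <#> K \<longleftrightarrow> (\<exists>h\<in>H. \<exists>k\<in>K. x = h \<otimes> k)"
  by (auto simp: set_mult_def)

lemma (in comm_monoid) hom_finprod:
  assumes closed: "\<And>x. x \<in> carrier G \<Longrightarrow> \<phi> x \<in> carrier G"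
    and mult: "\<And>x y. x \<in> carrier G \<Longrightarrow> y \<in> carrier G \<Longrightarrow> \<phi> (x \<otimes> y) = \<phi> x \<otimes> \<phi> y"
    and one: "\<phi> \<one> = \<one>"
    and f: "f \<in> S \<rightarrow> carrier G"
  shows "\<phi> (finprod G f S) = finprod G (\<lambda>i. \<phi> (f i)) S"
  using f
proof (induction S rule: infinite_finite_induct)
  case (insert i S)
  then have "f i \<in> carrier G" "f \<in> S \<rightarrow> carrier G" by auto
  with insert show ?case
    by (simp add: mult closed Pi_def)
qed (simp_all add: one)

text \<open>Any \<open>N\<close>-equivariant map \<open>\<theta> : G \<rightarrow> N\<close> that is right \<open>B\<close>-invariant
  is averaged over the left cosets of \<open>N B\<close> to a crossed homomorphism \<open>\<phi> : G \<rightarrow> N\<close>, which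
  restricts to the power map of exponent \<open>\<bar>G : N B\<bar>\<close> on \<open>N\<close>; its kernel is a complement.\<close>

theorem (in group) Gaschuetz_complement:
  assumes fin: "finite (carrier G)" and N: "N \<lhd> G"
    and comm: "\<And>x y. x \<in> N \<Longrightarrow> y \<in> N \<Longrightarrow> x \<otimes> y = y \<otimes> x"
    and B: "subgroup B G" and NB: "N \<inter> B = {\<one>}"
    and coprime: "coprime (card N) (card (lcosets (N <#> B)))"
  shows "\<exists>A. subgroup A G \<and> N \<inter> A = {\<one>} \<and> N <#> A = carrier G"
proof -
  interpret N: normal N G by (rule N)
  interpret B: subgroup B G by (rule B)
  define P where "P = N <#> B"
  interpret P: subgroup P G
    unfolding P_def by (rule mult_norm_subgroup[OF N B])
  \<comment> \<open>\<open>finprod\<close> needs a commutative monoid, so the abelian subgroup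
    \<open>N\<close> is made a group of its own.\<close>
  define M where "M = G\<lparr>carrier := N\<rparr>"
  have M_simps [simp]: "carrier M = N" "\<one>\<^bsub>M\<^esub> = \<one>" "monoid.mult M = (\<otimes>)"
    by (simp_all add: M_def)
  interpret M: comm_group M
    using comm subgroup_imp_group[OF N.is_subgroup] unfolding M_def
    by (intro group.group_comm_groupI) auto
  have M_pow: "x [^]\<^bsub>M\<^esub> k = x [^] k" for x and k :: nat
    unfolding M_def by (rule nat_pow_consistent[symmetric])
  have NG [simp]: "x \<in> carrier G" if "x \<in> N" for x
    using that by (rule N.mem_carrier)
  have BG [simp]: "x \<in> carrier G" if "x \<in> B" for x
    using that by (rule B.mem_carrier)
  note word = m_assoc inv_cancel_left inv_mult_group
  define cj where "cj g x = g \<otimes> x \<otimes> inv g" for g x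
  have cj_N [simp]: "cj g x \<in> N" if "g \<in> carrier G" "x \<in> N" for g x
    using that by (simp add: cj_def N.inv_op_closed2)
  have cj_mult: "cj g (x \<otimes> y) = cj g x \<otimes> cj g y"
    if "g \<in> carrier G" "x \<in> N" "y \<in> N" for g x y
    using that by (simp add: cj_def word)
  have cj_one [simp]: "cj g \<one> = \<one>" if "g \<in> carrier G" for g
    using that by (simp add: cj_def)
  have cj_cj: "cj g (cj h x) = cj (g \<otimes> h) x"
    if "g \<in> carrier G" "h \<in> carrier G" "x \<in> N" for g h x
    using that by (simp add: cj_def word)
  have cj_inv: "inv (cj g x) = cj g (inv x)" if "g \<in> carrier G" "x \<in> N" for g x
    using that by (simp add: cj_def word)
  have cj_triv: "cj m x = x" if "m \<in> N" "x \<in> N" for m x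
    using that comm[of m x] by (simp add: cj_def word)

  define t :: "'a set \<Rightarrow> 'a" where "t C = (SOME x. x \<in> C)" for C
  have t_mem: "t (g <# P) \<in> g <# P" if "g \<in> carrier G" for g
    unfolding t_def using lcos_self[OF that P.is_subgroup] by (rule someI)
  have t_G [simp]: "t (g <# P) \<in> carrier G" if "g \<in> carrier G" for g
    using t_mem[OF that] l_coset_subset_G[OF P.subset that] by blast
  have t_coset: "t (g <# P) <# P = g <# P" if "g \<in> carrier G" for g
    using l_repr_independence[OF t_mem[OF that] that P.is_subgroup] by simp
  have coset_mult_P: "(g \<otimes> u) <# P = g <# P" if "g \<in> carrier G" "u \<in> P" for g u
    using that l_repr_independence[of "g \<otimes> u" g P] P.is_subgroup
    by (auto simp: l_coset_def)
  have N_P: "x \<in> P" if "x \<in> N" for x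
    using that B.one_closed unfolding P_def mem_set_mult by (metis NG r_one)
  have B_P: "x \<in> P" if "x \<in> B" for x
    using that N.one_closed unfolding P_def mem_set_mult by (metis BG l_one)
  have coset_mult_N: "(m \<otimes> g) <# P = g <# P" if "m \<in> N" "g \<in> carrier G" for m g
  proof -
    have "m \<otimes> g = g \<otimes> (inv g \<otimes> m \<otimes> g)"
      using that by (simp add: word)
    then show ?thesis
      using that coset_mult_P[of g "inv g \<otimes> m \<otimes> g"] N_P N.inv_op_closed1 by simp
  qed

  \<comment> \<open>Since \<open>N\<close> is normal, the elements of the coset \<open>t P\<close>
    have the form \<open>n t b\<close>. The factor \<open>n\<close> is unique because
    \<open>N \<inter> B\<close> is trivial; it becomes \<open>\<theta> g\<close>.\<close>
  define is_\<theta> where "is_\<theta> g n \<longleftrightarrow> n \<in> N \<and> (\<exists>b\<in>B. g = n \<otimes> t (g <# P) \<otimes> b)" for g n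
  have "\<exists>!n. is_\<theta> g n" if g: "g \<in> carrier G" for g
  proof -
    let ?t = "t (g <# P)"
    have "g \<in> ?t <# P"
      using t_coset[OF g] lcos_self[OF g P.is_subgroup] by simp
    then obtain n b where nb: "n \<in> N" "b \<in> B" "g = ?t \<otimes> (n \<otimes> b)"
      by (auto simp: l_coset_def P_def mem_set_mult)
    then have "g = cj ?t n \<otimes> ?t \<otimes> b"
      using g by (simp add: cj_def word del: t_G) (metis t_G m_closed word NG BG inv_closed)
    then have "is_\<theta> g (cj ?t n)"
      using nb g by (auto simp: is_\<theta>_def)
    moreover have "n1 = n2" if n12: "is_\<theta> g n1" "is_\<theta> g n2" for n1 n2
    proof -
      obtain b1 b2 where *: "n1 \<in> N" "n2 \<in> N" "b1 \<in> B" "b2 \<in> B"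
        "g = n1 \<otimes> ?t \<otimes> b1" "g = n2 \<otimes> ?t \<otimes> b2"
        using n12 unfolding is_\<theta>_def by blast
      have tG: "?t \<in> carrier G" using g by simp
      have "inv ?t \<otimes> (inv n2 \<otimes> n1) \<otimes> ?t = inv ?t \<otimes> (inv n2 \<otimes> (n1 \<otimes> ?t \<otimes> b1)) \<otimes> inv b1"
        using *(1-4) tG by (simp add: word)
      also have "\<dots> = inv ?t \<otimes> (inv n2 \<otimes> (n2 \<otimes> ?t \<otimes> b2)) \<otimes> inv b1"
        using *(5,6) by simp
      also have "\<dots> = b2 \<otimes> inv b1"
        using *(1-4) tG by (simp add: word)
      finally have eq: "inv ?t \<otimes> (inv n2 \<otimes> n1) \<otimes> ?t = b2 \<otimes> inv b1" .
      have "inv ?t \<otimes> (inv n2 \<otimes> n1) \<otimes> ?t \<in> N"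
        using *(1-4) tG by (intro N.inv_op_closed1) auto
      with eq NB *(1-4) have "inv ?t \<otimes> (inv n2 \<otimes> n1) \<otimes> ?t = \<one>"
        by (metis B.m_closed B.m_inv_closed IntI singletonD)
      then have "?t \<otimes> (inv ?t \<otimes> (inv n2 \<otimes> n1) \<otimes> ?t) \<otimes> inv ?t = \<one>"
        using tG by simp
      then have "inv n2 \<otimes> n1 = \<one>"
        using *(1-4) tG by (simp add: word)
      then show "n1 = n2"
        using *(1-4) by (metis NG inv_closed inv_equality inv_inv)
    qed
    ultimately show ?thesis by blast
  qed
  then obtain \<theta> where \<theta>: "\<And>g. g \<in> carrier G \<Longrightarrow> is_\<theta> g (\<theta> g)"
    and \<theta>_unique: "\<And>g n. g \<in> carrier G \<Longrightarrow> is_\<theta> g n \<Longrightarrow> \<theta> g = n"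
    by metis
  have \<theta>_N [simp]: "\<theta> g \<in> N" if "g \<in> carrier G" for g
    using \<theta>[OF that] by (simp add: is_\<theta>_def)
  have \<theta>_left: "\<theta> (m \<otimes> g) = m \<otimes> \<theta> g" if mg: "m \<in> N" "g \<in> carrier G" for m g
  proof (rule \<theta>_unique)
    obtain b where b: "b \<in> B" "g = \<theta> g \<otimes> t (g <# P) \<otimes> b"
      using \<theta>[OF mg(2)] by (auto simp: is_\<theta>_def)
    then have "m \<otimes> g = m \<otimes> (\<theta> g \<otimes> t (g <# P) \<otimes> b)" by simp
    also have "\<dots> = (m \<otimes> \<theta> g) \<otimes> t ((m \<otimes> g) <# P) \<otimes> b"
      using that b(1) by (simp add: coset_mult_N word)
    finally show "is_\<theta> (m \<otimes> g) (m \<otimes> \<theta> g)"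
      using that b(1) by (auto simp: is_\<theta>_def)
  qed (use that in auto)
  have \<theta>_right: "\<theta> (g \<otimes> c) = \<theta> g" if cg: "c \<in> B" "g \<in> carrier G" for c g
  proof (rule \<theta>_unique)
    obtain b where b: "b \<in> B" "g = \<theta> g \<otimes> t (g <# P) \<otimes> b"
      using \<theta>[OF cg(2)] by (auto simp: is_\<theta>_def)
    then have "g \<otimes> c = (\<theta> g \<otimes> t (g <# P) \<otimes> b) \<otimes> c" by simp
    also have "\<dots> = \<theta> g \<otimes> t ((g \<otimes> c) <# P) \<otimes> (b \<otimes> c)"
      using that b(1) by (simp add: coset_mult_P B_P word)
    finally show "is_\<theta> (g \<otimes> c) (\<theta> g)"
      using that b(1) by (auto simp: is_\<theta>_def)
  qed (use that in auto)

  \<comment> \<open>\<open>h x s\<close> compares \<open>\<theta> (x \<otimes> s)\<close> with the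
    conjugate of \<open>\<theta> s\<close> by \<open>x\<close>. Replacing \<open>s\<close> by
    \<open>s \<otimes> u\<close> with \<open>u \<in> P\<close> multiplies the two parts by mutually
    inverse elements of the abelian group \<open>N\<close>, so \<open>h x s\<close> depends only on
    the coset of \<open>s\<close>.\<close>
  define h where "h x s = \<theta> (x \<otimes> s) \<otimes> cj x (inv (\<theta> s))" for x s
  have h_N [simp]: "h x s \<in> N" if "x \<in> carrier G" "s \<in> carrier G" for x s
    using that by (simp add: h_def)
  have h_P: "h x (s \<otimes> u) = h x s" if xsu: "x \<in> carrier G" "s \<in> carrier G" "u \<in> P" for x s u
  proof -
    obtain n b where nb: "n \<in> N" "b \<in> B" "u = n \<otimes> b"
      using xsu(3) by (auto simp: P_def mem_set_mult)
    have \<theta>u: "\<theta> (g \<otimes> u) = cj g n \<otimes> \<theta> g" if g: "g \<in> carrier G" for g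
    proof -
      have "g \<otimes> u = (cj g n \<otimes> g) \<otimes> b"
        using nb g by (simp add: cj_def word)
      then show ?thesis
        using nb g by (simp add: \<theta>_left \<theta>_right)
    qed
    have "\<theta> (x \<otimes> (s \<otimes> u)) = cj (x \<otimes> s) n \<otimes> \<theta> (x \<otimes> s)"
      using \<theta>u[of "x \<otimes> s"] xsu by (simp add: m_assoc)
    moreover have "cj x (inv (\<theta> (s \<otimes> u))) = cj x (inv (\<theta> s)) \<otimes> inv (cj (x \<otimes> s) n)"
      using xsu nb(1) by (simp add: \<theta>u inv_mult_group cj_mult cj_inv cj_cj)
    ultimately have "h x (s \<otimes> u) =
        cj (x \<otimes> s) n \<otimes> (h x s \<otimes> inv (cj (x \<otimes> s) n))"
      using xsu nb(1) by (simp add: h_def m_assoc)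
    also have "\<dots> = h x s"
      using xsu nb(1) comm[of "h x s" "inv (cj (x \<otimes> s) n)"] by (simp add: inv_cancel_left)
    finally show ?thesis .
  qed
  have h_coset: "h x (t C) = h x s" if "x \<in> carrier G" "s \<in> carrier G" "C = s <# P" for x s C
  proof -
    have "t C \<in> s <# P" using t_mem that by simp
    then obtain u where "u \<in> P" "t C = s \<otimes> u" by (auto simp: l_coset_def)
    then show ?thesis using h_P that by simp
  qed
  \<comment> \<open>The identity of a crossed homomorphism, except that \<open>s\<close> is shifted
    to \<open>y \<otimes> s\<close>. The shift permutes the cosets and disappears in the product
    over all of them.\<close>
  have h_mult: "h (x \<otimes> y) s = h x (y \<otimes> s) \<otimes> cj x (h y s)"
    if "x \<in> carrier G" "y \<in> carrier G" "s \<in> carrier G" for x y s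
    using that cj_inv[of x "\<theta> (y \<otimes> s)"]
    by (simp add: h_def cj_mult cj_cj word flip: cj_inv)

  define \<phi> where "\<phi> x = finprod M (\<lambda>C. h x (t C)) (lcosets P)" for x
  have coset_G: "\<exists>g\<in>carrier G. C = g <# P" if "C \<in> lcosets P" for C
    using that by (auto simp: LCOSETS_def)
  then have tC_G [simp]: "t C \<in> carrier G" if "C \<in> lcosets P" for C
    using that by (metis t_G)
  have h_Pi [simp]: "(\<lambda>C. h x (t C)) \<in> lcosets P \<rightarrow> N" if "x \<in> carrier G" for x
    using that by auto
  have \<phi>_N [simp]: "\<phi> x \<in> N" if "x \<in> carrier G" for x
    using that M.finprod_closed[of "\<lambda>C. h x (t C)"] by (simp add: \<phi>_def)
  have shift: "(\<lambda>C. y <# C) ` (lcosets P) = lcosets P" "inj_on (\<lambda>C. y <# C) (lcosets P)"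
    if y: "y \<in> carrier G" for y
  proof -
    have cancel: "inv y <# (y <# C) = C" "y <# (inv y <# C) = C" if "C \<in> lcosets P" for C
      using that y P.lcosets_carrier[OF is_group that] by (simp_all add: lcos_m_assoc lcos_mult_one)
    have closed: "z <# C \<in> lcosets P" if "C \<in> lcosets P" "z \<in> carrier G" for z C
      using that by (auto simp: LCOSETS_def lcos_m_assoc P.subset)
    show "inj_on (\<lambda>C. y <# C) (lcosets P)"
      by (rule inj_on_inverseI[of _ "\<lambda>C. inv y <# C"]) (rule cancel)
    show "(\<lambda>C. y <# C) ` (lcosets P) = lcosets P"
      using closed y cancel(2) by (auto simp: image_iff) (metis inv_closed)
  qed
  have \<phi>_mult: "\<phi> (x \<otimes> y) = \<phi> x \<otimes> cj x (\<phi> y)" if x: "x \<in> carrier G" and y: "y \<in> carrier G" for x y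
  proof -
    have yC: "y <# C \<in> lcosets P" if "C \<in> lcosets P" for C
      using shift(1)[OF y] that by blast
    have "h (x \<otimes> y) (t C) = h x (t (y <# C)) \<otimes> cj x (h y (t C))" if C: "C \<in> lcosets P" for C
    proof -
      obtain g where g: "g \<in> carrier G" "C = g <# P" using coset_G[OF C] by blast
      have "y <# C = (y \<otimes> t C) <# P"
        using g y t_coset[of g] by (simp add: lcos_m_assoc[symmetric] P.subset)
      then have "h x (t (y <# C)) = h x (y \<otimes> t C)"
        using x y C by (intro h_coset) auto
      then show ?thesis using h_mult x y C by simp
    qed
    then have "\<phi> (x \<otimes> y) = finprod M (\<lambda>C. h x (t (y <# C)) \<otimes>\<^bsub>M\<^esub> cj x (h y (t C))) (lcosets P)"
      unfolding \<phi>_def using x y by (intro M.finprod_cong) (auto simp: simp_implies_def)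
    also have "\<dots> = finprod M (\<lambda>C. h x (t (y <# C))) (lcosets P) \<otimes>
        finprod M (\<lambda>C. cj x (h y (t C))) (lcosets P)"
      using x y yC by (subst M.finprod_multf) auto
    also have "finprod M (\<lambda>C. h x (t (y <# C))) (lcosets P) = \<phi> x"
      unfolding \<phi>_def using M.finprod_reindex[OF _ shift(2)[OF y], of "\<lambda>C. h x (t C)"] x
      by (simp add: shift(1)[OF y])
    also have "finprod M (\<lambda>C. cj x (h y (t C))) (lcosets P) = cj x (\<phi> y)"
      unfolding \<phi>_def using x y by (intro M.hom_finprod[symmetric]) (auto simp: cj_mult)
    finally show ?thesis .
  qed
  have \<phi>_pow: "\<phi> n = n [^] card (lcosets P)" if n: "n \<in> N" for n
  proof -
    have "h n s = n" if "s \<in> carrier G" for s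
      using n that by (simp add: h_def \<theta>_left cj_triv m_assoc)
    then have "\<phi> n = finprod M (\<lambda>C. n) (lcosets P)"
      unfolding \<phi>_def using n by (intro M.finprod_cong) (auto simp: simp_implies_def)
    then show ?thesis
      using n M.finprod_const[of n] by (simp add: M_pow)
  qed
  have pow_card: "n [^] card N = \<one>" if "n \<in> N" for n
    using M.pow_order_eq_1[of n] that by (simp add: order_def M_pow)
  have \<phi>_one: "\<phi> \<one> = \<one>"
    using \<phi>_pow[of \<one>] by simp

  let ?A = "{x \<in> carrier G. \<phi> x = \<one>}"
  have "subgroup ?A G"
  proof
    show "x \<otimes> y \<in> ?A" if "x \<in> ?A" "y \<in> ?A" for x y
      using that by (simp add: \<phi>_mult)
    show "inv x \<in> ?A" if x: "x \<in> ?A" for x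
    proof -
      have "\<phi> (inv x \<otimes> x) = \<phi> (inv x) \<otimes> cj (inv x) (\<phi> x)"
        using x by (intro \<phi>_mult) auto
      then show ?thesis using x by (simp add: \<phi>_one)
    qed
  qed (auto simp: \<phi>_one)
  moreover have NA: "N \<inter> ?A = {\<one>}"
  proof -
    have "n = \<one>" if n: "n \<in> N" "n [^] card (lcosets P) = \<one>" for n
    proof -
      have "ord n dvd card N" "ord n dvd card (lcosets P)"
        using n pow_card by (simp_all flip: pow_eq_id)
      then have "ord n = 1"
        using coprime unfolding P_def[symmetric] by (metis coprime_common_divisor_nat nat_dvd_1_iff_1)
      then show ?thesis using n(1) by (metis NG ord_eq_1)
    qed
    then show ?thesis using \<phi>_pow \<phi>_one by auto
  qed
  moreover have "N <#> ?A = carrier G"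
  proof
    show "N <#> ?A \<subseteq> carrier G" by (auto simp: mem_set_mult)
    show "carrier G \<subseteq> N <#> ?A"
    proof
      fix x assume x: "x \<in> carrier G"
      have \<phi>_inv: "\<phi> (inv n) = inv (\<phi> n)" if "n \<in> N" for n
        using that by (simp add: \<phi>_pow nat_pow_inv)
      have "inj_on \<phi> N"
      proof (rule inj_onI)
        fix m n assume mn: "m \<in> N" "n \<in> N" "\<phi> m = \<phi> n"
        then have "\<phi> (inv n \<otimes> m) = \<one>"
          by (simp add: \<phi>_mult cj_triv \<phi>_inv)
        with mn have "inv n \<otimes> m \<in> N \<inter> ?A" by simp
        then have "inv n \<otimes> m = \<one>"
          unfolding NA by simp
        then show "m = n"
          using mn by (metis NG inv_closed inv_equality inv_inv)
      qed
      \<comment> \<open>An injective self-map of the finite set \<open>N\<close> is onto, so some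
        \<open>n\<close> has the same value as \<open>x\<close>. As conjugation by \<open>n\<close>
        is trivial on \<open>N\<close>, the element \<open>inv n \<otimes> x\<close> lies in the
        kernel.\<close>
      then have "\<phi> ` N = N"
        using fin N.subset by (intro endo_inj_surj) (auto intro: finite_subset)
      then obtain n where n: "n \<in> N" "\<phi> n = \<phi> x"
        using x by (metis \<phi>_N imageE)
      have "\<phi> (inv n \<otimes> x) = \<one>"
        using n x by (simp add: \<phi>_mult cj_triv \<phi>_inv)
      then have "inv n \<otimes> x \<in> ?A" "x = n \<otimes> (inv n \<otimes> x)"
        using n x by (simp_all add: inv_cancel_left)
      with n show "x \<in> N <#> ?A" by (auto simp: mem_set_mult)
    qed
  qed
  ultimately show ?thesis by blast
qed

section \<open>Complements of prime chief factors\<close>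

lemma (in group) card_subgroup_dvd:
  assumes "finite (carrier G)" "subgroup H G" "subgroup K G" "H \<subseteq> K"
  shows "card H dvd card K"
proof -
  interpret K: group "G\<lparr>carrier := K\<rparr>"
    using assms(3) by (rule subgroup_imp_group)
  have "subgroup H (G\<lparr>carrier := K\<rparr>)"
    using assms by (intro subgroup_incl)
  from K.lagrange[OF this] have "card (rcosets\<^bsub>G\<lparr>carrier := K\<rparr>\<^esub> H) * card H = card K"
    by (simp add: order_def)
  then show ?thesis by (metis dvd_triv_right)
qed

lemma (in group) card_set_mult_trivial_inter:
  assumes "subgroup H G" "subgroup K G" "H \<inter> K = {\<one>}"
  shows "card (H <#> K) = card H * card K"
proof -
  interpret H: subgroup H G by fact
  interpret K: subgroup K G by fact
  have "inj_on (\<lambda>(h, k). h \<otimes> k) (H \<times> K)"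
  proof (rule inj_onI, clarify)
    fix h k h' k'
    assume *: "h \<in> H" "k \<in> K" "h' \<in> H" "k' \<in> K" "h \<otimes> k = h' \<otimes> k'"
    then have G: "h \<in> carrier G" "k \<in> carrier G" "h' \<in> carrier G" "k' \<in> carrier G"
      by auto
    have "inv h' \<otimes> h = inv h' \<otimes> (h \<otimes> k) \<otimes> inv k"
      using G by (simp add: m_assoc)
    also have "\<dots> = inv h' \<otimes> (h' \<otimes> k') \<otimes> inv k"
      using *(5) by simp
    also have "\<dots> = k' \<otimes> inv k"
      using G by (simp add: m_assoc inv_cancel_left)
    finally have "inv h' \<otimes> h = k' \<otimes> inv k" .
    moreover have "inv h' \<otimes> h \<in> H" "k' \<otimes> inv k \<in> K"
      using * by auto
    ultimately have "inv h' \<otimes> h = \<one>" "k' \<otimes> inv k = \<one>"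
      using assms(3) by auto
    then show "h = h' \<and> k = k'"
      using G by (metis inv_closed inv_equality inv_inv)
  qed
  moreover have "(\<lambda>(h, k). h \<otimes> k) ` (H \<times> K) = H <#> K"
    by (auto simp: set_mult_def)
  ultimately show ?thesis
    by (metis card_image card_cartesian_product)
qed

text \<open>Complements of subspaces over the field with \<open>p\<close> elements, in group terms:
  let \<open>B\<close> be maximal among the subgroups of \<open>S\<close> meeting \<open>N\<close>
  trivially. For \<open>x\<close> outside \<open>N <#> B\<close>, the subgroup generated by
  \<open>B\<close> and \<open>x\<close> would still meet \<open>N\<close> trivially.\<close>

lemma (in group) elementary_abelian_complement:
  assumes fin: "finite (carrier G)" and S: "subgroup S G" and p: "prime (p :: nat)"
    and comm: "\<And>x y. x \<in> S \<Longrightarrow> y \<in> S \<Longrightarrow> x \<otimes> y = y \<otimes> x"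
    and pow: "\<And>x. x \<in> S \<Longrightarrow> x [^] p = \<one>"
    and N: "N \<lhd> G" "N \<subseteq> S"
  shows "\<exists>B. subgroup B G \<and> N \<inter> B = {\<one>} \<and> N <#> B = S"
proof -
  interpret S: subgroup S G by fact
  interpret N: normal N G by fact
  let ?X = "{B. subgroup B G \<and> B \<subseteq> S \<and> N \<inter> B = {\<one>}}"
  have "{\<one>} \<in> ?X"
    using triv_subgroup by auto
  then have "?X \<noteq> {}" by blast
  moreover have "finite ?X"
    using fin subgroup.subset by (intro finite_subset[of ?X "Pow (carrier G)"]) auto
  ultimately have "\<exists>B\<in>?X. \<forall>C\<in>?X. B \<subseteq> C \<longrightarrow> B = C"
    by (intro finite_has_maximal)
  then obtain B where B: "B \<in> ?X" and max: "\<And>C. C \<in> ?X \<Longrightarrow> B \<subseteq> C \<Longrightarrow> B = C"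
    by (elim bexE) (rule that, auto)
  then interpret B: subgroup B G by simp
  have BS: "B \<subseteq> S" and NB: "N \<inter> B = {\<one>}" using B by auto
  interpret NB: subgroup "N <#> B" G
    by (rule mult_norm_subgroup[OF N(1) B.is_subgroup])
  have "x \<in> N <#> B" if x: "x \<in> S" for x
  proof (rule ccontr)
    assume nx: "x \<notin> N <#> B"
    have xG [simp]: "x \<in> carrier G" using x by simp
    have xk_S: "x [^] k \<in> S" for k :: nat
      using x by (induction k) auto
    \<comment> \<open>The subgroup generated by \<open>B\<close> and \<open>x\<close>. Natural
      exponents suffice because \<open>x [^] p = \<one>\<close> turns the inverse of
      \<open>x [^] k\<close> into \<open>x [^] ((p - 1) * k)\<close>.\<close>
    let ?C = "{b \<otimes> x [^] k | b (k :: nat). b \<in> B}"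
    have C: "subgroup ?C G"
    proof (rule subgroupI)
      show "?C \<subseteq> carrier G" by auto
      show "?C \<noteq> {}" using B.one_closed by blast
      fix u assume "u \<in> ?C"
      then obtain b and k :: nat where b: "b \<in> B" and u: "u = b \<otimes> x [^] k" by blast
      have "(p - 1) * k + k = p * k"
        using prime_gt_0_nat[OF p] by (cases p) auto
      then have "x [^] ((p - 1) * k) \<otimes> x [^] k = (x [^] p) [^] k"
        by (simp add: nat_pow_mult nat_pow_pow)
      then have "inv (x [^] k) = x [^] ((p - 1) * k)"
        using pow[OF x] by (intro inv_equality) auto
      then have "inv u = inv b \<otimes> x [^] ((p - 1) * k)"
        using b u BS xk_S comm[of "inv b" "x [^] ((p - 1) * k)"] by (auto simp: inv_mult_group)
      then show "inv u \<in> ?C" using b by blast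
      fix v assume "v \<in> ?C"
      then obtain c and m :: nat where c: "c \<in> B" and v: "v = c \<otimes> x [^] m" by blast
      have "x [^] k \<otimes> c = c \<otimes> x [^] k"
        using c BS xk_S by (intro comm) auto
      then have "u \<otimes> v = (b \<otimes> c) \<otimes> x [^] (k + m)"
        using b c unfolding u v
        by (metis (no_types, opaque_lifting) B.mem_carrier m_assoc m_closed nat_pow_closed nat_pow_mult xG)
      then show "u \<otimes> v \<in> ?C" using b c by blast
    qed
    have "?C \<subseteq> S"
      using BS xk_S by auto
    have "u = \<one>" if u: "u \<in> N" "u \<in> ?C" for u
    proof -
      obtain b and k :: nat where b: "b \<in> B" and uk: "u = b \<otimes> x [^] k"
        using u(2) by blast
      show ?thesis
      proof (cases "p dvd k")
        case True
        then have "x [^] k = \<one>"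
          using pow[OF x] by (auto elim!: dvdE simp flip: nat_pow_pow)
        then have "u = b" using uk b by simp
        then show ?thesis using u(1) b NB by blast
      next
        case False
        then have "coprime k p"
          using p prime_imp_coprime coprime_commute by blast
        then have "k \<noteq> 0 \<or> p = 1" by (cases "k = 0") auto
        then have "k \<noteq> 0" using p by (auto dest: prime_gt_1_nat)
        \<comment> \<open>By Bezout, \<open>(x [^] k) [^] i\<close> equals \<open>x\<close> up to a
          power of \<open>x [^] p = \<one>\<close>. So \<open>x [^] k\<close> in
          \<open>N <#> B\<close> would force \<open>x\<close> into it.\<close>
        then obtain i j where ij: "k * i = p * j + 1"
          using bezout_nat[of k p] \<open>coprime k p\<close> by auto
        have xk: "x [^] k = inv b \<otimes> u"
          using uk b by (simp add: inv_cancel_left)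
        have "inv b \<in> N <#> B" "u \<in> N <#> B"
          using b u(1) N.one_closed B.one_closed unfolding mem_set_mult
          by (metis B.m_inv_closed B.mem_carrier l_one, metis N.mem_carrier r_one)
        then have "x [^] k \<in> N <#> B"
          by (simp add: xk)
        then have "(x [^] k) [^] i \<in> N <#> B"
          by (induction i) auto
        moreover have "(x [^] k) [^] i = (x [^] p) [^] j \<otimes> x"
          by (simp add: nat_pow_pow ij)
        ultimately show ?thesis
          using nx pow[OF x] by simp
      qed
    qed
    then have "N \<inter> ?C = {\<one>}"
      using subgroup.one_closed[OF C] N.one_closed by blast
    moreover have "B \<subseteq> ?C"
    proof
      fix b assume "b \<in> B"
      then have "b = b \<otimes> x [^] (0::nat)" by simp
      then show "b \<in> ?C" using \<open>b \<in> B\<close> by blast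
    qed
    ultimately have "B = ?C"
      using C \<open>?C \<subseteq> S\<close> by (intro max) simp_all
    moreover have "x = \<one> \<otimes> x [^] (1::nat)" by simp
    then have "x \<in> ?C" using B.one_closed by blast
    ultimately have "x \<in> B" by simp
    then have "x = \<one> \<otimes> x" by simp
    then show False
      using nx \<open>x \<in> B\<close> N.one_closed unfolding mem_set_mult by blast
  qed
  then have "N <#> B = S"
    using BS N(2) S.m_closed unfolding set_eq_iff mem_set_mult by (metis subsetD)
  then show ?thesis
    using B.is_subgroup NB by blast
qed

text \<open>Since \<open>S\<close> has index prime to \<open>p\<close>, it contains the normal \<open>p\<close>-subgroup \<open>N\<close>.\<close>

lemma (in group) prime_normal_subgroup_complement:
  assumes fin: "finite (carrier G)" and N: "N \<lhd> G" "prime (card N)"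
    and S: "subgroup S G" and index: "order G = card S * m" "\<not> card N dvd m"
    and comm: "\<And>x y. x \<in> S \<Longrightarrow> y \<in> S \<Longrightarrow> x \<otimes> y = y \<otimes> x"
    and pow: "\<And>x. x \<in> S \<Longrightarrow> x [^] card N = \<one>"
  shows "\<exists>A. subgroup A G \<and> N \<inter> A = {\<one>} \<and> N <#> A = carrier G"
proof -
  interpret S: subgroup S G by fact
  interpret N: normal N G by fact
  have finS: "finite S" and finN: "finite N"
    using fin S.subset N.subset finite_subset by blast+
  have NS_sub: "subgroup (N \<inter> S) G"
    using N.is_subgroup S by (rule subgroups_Inter_pair)
  have "N \<subseteq> S"
  proof -
    have "card (N \<inter> S) dvd card N"
      using fin NS_sub N.is_subgroup by (rule card_subgroup_dvd) auto
    then consider "card (N \<inter> S) = 1" | "card (N \<inter> S) = card N"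
      using N(2) prime_nat_iff by blast
    then show ?thesis
    proof cases
      \<comment> \<open>Then \<open>N <#> S\<close> is a subgroup of order
        \<open>card N * card S\<close>, so \<open>card N\<close> would divide the index
        \<open>m\<close> of \<open>S\<close>.\<close>
      case 1
      then have "N \<inter> S = {\<one>}"
        using N.one_closed S.one_closed by (metis IntI card_1_singletonE singletonD)
      then have "card N * card S = card (N <#> S)"
        using card_set_mult_trivial_inter N.is_subgroup S by simp
      also have "\<dots> dvd order G"
        using fin mult_norm_subgroup[OF N(1) S] by (metis lagrange dvd_triv_right)
      finally have "card S * card N dvd card S * m"
        using index(1) by (simp add: mult.commute)
      moreover have "card S \<noteq> 0"
        using finS S.one_closed by (metis card_0_eq empty_iff)
      ultimately show ?thesis
        using index(2) by simp
    next
      case 2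
      then show ?thesis
        using finN by (metis card_subset_eq inf_le1 inf_le2)
    qed
  qed
  then obtain B where B: "subgroup B G" "N \<inter> B = {\<one>}" "N <#> B = S"
    using elementary_abelian_complement[OF fin S N(2) comm pow N(1)] by blast
  have "card (lcosets S) * card S = card S * m"
    using l_lagrange[OF fin S] index(1) by simp
  moreover have "card S \<noteq> 0"
    using finS S.one_closed by (metis card_0_eq empty_iff)
  ultimately have "card (lcosets S) = m" by simp
  then have "coprime (card N) (card (lcosets (N <#> B)))"
    using index(2) N(2) B(3) by (simp add: prime_imp_coprime)
  moreover have "x \<otimes> y = y \<otimes> x" if "x \<in> N" "y \<in> N" for x y
    using that comm \<open>N \<subseteq> S\<close> by blast
  ultimately show ?thesis
    using B(1,2) by (intro Gaschuetz_complement[OF fin N(1)])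
qed

lemma (in normal) card_preimage_Mod:
  assumes "finite (carrier G)" "T \<subseteq> carrier (G Mod H)"
  shows "card {x \<in> carrier G. H #> x \<in> T} = card T * card H"
proof -
  have T: "T \<subseteq> rcosets H"
    using assms(2) by (simp add: FactGroup_def)
  have sub: "C \<subseteq> carrier G" if "C \<in> T" for C
    using that T rcosets_carrier[OF is_group] by blast
  have "{x \<in> carrier G. H #> x \<in> T} = \<Union>T"
  proof (intro equalityI subsetI)
    fix x assume "x \<in> {x \<in> carrier G. H #> x \<in> T}"
    then show "x \<in> \<Union>T" using rcos_self[OF _ is_subgroup] by blast
  next
    fix x assume "x \<in> \<Union>T"
    then obtain C where C: "C \<in> T" "x \<in> C" by blast
    then obtain g where g: "g \<in> carrier G" "C = H #> g"
      using T by (auto simp: RCOSETS_def)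
    then have "H #> x = C"
      using repr_independence[of x H g] C is_subgroup by simp
    then show "x \<in> {x \<in> carrier G. H #> x \<in> T}"
      using C sub by auto
  qed
  moreover have "finite T" "finite (\<Union>T)"
    using assms(1) sub by (auto intro: finite_subset[of _ "Pow (carrier G)"] finite_subset[of _ "carrier G"])
  moreover have "card C = card H" if "C \<in> T" for C
    using card_rcosets_equal[of C H] that T subset by auto
  moreover have "C1 \<inter> C2 = {}" if "C1 \<in> T" "C2 \<in> T" "C1 \<noteq> C2" for C1 C2
    using rcos_disjoint[OF is_subgroup] that T by (auto simp: pairwise_def disjnt_def)
  ultimately show ?thesis
    using card_partition[of T "card H"] by (simp add: mult.commute)
qed

text \<open>In the quotient \<open>Q\<close> of \<open>G\<close> by \<open>K\<close> the image of
  \<open>M\<close> is a normal subgroup of order \<open>p\<close>, which has a complement by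
  \<open>prime_normal_subgroup_complement\<close>; its preimage is the required
  \<open>A\<close>.\<close>

theorem (in group) prime_factor_complement:
  assumes fin: "finite (carrier G)" and K: "K \<lhd> G" and M: "M \<lhd> G" "K \<subseteq> M"
    and p: "prime p" "card M = p * card K"
    and S: "subgroup S G" "card S = p ^ multiplicity p (order G)"
    and comm: "\<And>x y. x \<in> S \<Longrightarrow> y \<in> S \<Longrightarrow> x \<otimes> y = y \<otimes> x"
    and pow: "\<And>x. x \<in> S \<Longrightarrow> x [^] p = \<one>"
  shows "\<exists>A. subgroup A G \<and> K \<subseteq> A \<and> A \<inter> M \<subseteq> K \<and> M <#> A = carrier G"
proof -
  interpret K: normal K G by fact
  interpret M: normal M G by fact
  interpret S: subgroup S G by fact
  define Q where "Q = G Mod K"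
  define \<pi> where "\<pi> x = K #> x" for x
  interpret Q: group Q
    unfolding Q_def by (rule K.factorgroup_is_group)
  have hom: "\<pi> \<in> hom G Q"
    unfolding Q_def \<pi>_def using K.r_coset_hom_Mod by simp
  interpret \<pi>: group_hom G Q \<pi>
    by (unfold_locales) (rule hom)
  have carrier_Q: "carrier Q = \<pi> ` carrier G"
    by (simp add: Q_def \<pi>_def carrier_FactGroup)
  have one_Q: "\<one>\<^bsub>Q\<^esub> = K"
    by (simp add: Q_def)
  have ker: "\<pi> x = K \<longleftrightarrow> x \<in> K" if "x \<in> carrier G" for x
    using that coset_join1[of K x] coset_join2[of x K] K.is_subgroup K.subset
    by (auto simp: \<pi>_def)
  have finQ: "finite (carrier Q)" using fin by (simp add: carrier_Q)
  have preimage: "card {x \<in> carrier G. \<pi> x \<in> T} = card T * card K" if "T \<subseteq> carrier Q" for T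
    using K.card_preimage_Mod[OF fin] that by (simp add: Q_def \<pi>_def)
  have cardK: "card K > 0"
    using K.one_closed finite_subset[OF K.subset fin] by (metis card_gt_0_iff empty_iff)
  have M_preimage: "{x \<in> carrier G. \<pi> x \<in> \<pi> ` M} = M"
  proof (intro equalityI subsetI)
    fix x assume "x \<in> {x \<in> carrier G. \<pi> x \<in> \<pi> ` M}"
    then obtain m where x: "x \<in> carrier G" and m: "m \<in> M" "\<pi> x = \<pi> m" by auto
    then have "x \<in> K #> m"
      using rcos_self[OF x K.is_subgroup] by (simp add: \<pi>_def)
    then show "x \<in> M"
      using m(1) M(2) by (auto simp: r_coset_def)
  qed auto
  have M'Q: "\<pi> ` M \<subseteq> carrier Q" and S'Q: "\<pi> ` S \<subseteq> carrier Q"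
    by (auto simp: carrier_Q)
  have cardM: "card (\<pi> ` M) = p"
    using preimage[OF M'Q] cardK p(2) by (simp add: M_preimage)
  have "\<pi> ` M \<lhd> Q"
    using M.surj_hom_normal_subgroup[OF \<pi>.group_hom_axioms carrier_Q[symmetric]] .
  moreover have S': "subgroup (\<pi> ` S) Q"
    using S(1) by (rule \<pi>.subgroup_img_is_subgroup)
  \<comment> \<open>The image of \<open>S\<close> has the same index as its preimage
    \<open>?P\<close>. As \<open>?P\<close> contains \<open>S\<close>, this index divides that of
    \<open>S\<close>, which is prime to \<open>p\<close>.\<close>
  moreover obtain l where l: "order Q = card (\<pi> ` S) * l" "\<not> p dvd l"
  proof -
    let ?P = "{x \<in> carrier G. \<pi> x \<in> \<pi> ` S}"
    have P: "subgroup ?P G"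
      using subgroup.m_closed[OF S'] subgroup.m_inv_closed[OF S'] subgroup.one_closed[OF S']
      by (intro subgroupI) (auto simp del: image_iff simp flip: \<pi>.hom_one)
    then have "card S dvd card ?P"
      using fin S(1) by (intro card_subgroup_dvd) auto
    then obtain k where k: "card ?P = card S * k" by (rule dvdE)
    define l where "l = card (rcosets ?P)"
    have l: "order G = card ?P * l"
      using lagrange[OF P] by (simp only: l_def mult.commute)
    have "card S * (k * l) = order G"
      using l unfolding k by (simp only: mult.assoc)
    moreover have "order G \<noteq> 0"
      using fin one_closed by (metis card_0_eq empty_iff order_def)
    then have "\<not> p ^ Suc (multiplicity p (order G)) dvd order G"
      using power_dvd_iff_le_multiplicity[of "order G" p] prime_gt_1_nat[OF p(1)] by (simp del: power_Suc)
    ultimately have "\<not> p dvd k * l"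
      using S(2) by (metis mult_dvd_mono dvd_refl power_Suc2)
    then have "\<not> p dvd l" by (metis dvd_mult)
    moreover have "{x \<in> carrier G. \<pi> x \<in> carrier Q} = carrier G"
      by auto
    then have "order Q * card K = order G"
      using preimage[of "carrier Q"] by (simp add: order_def)
    then have "order Q * card K = (card (\<pi> ` S) * card K) * l"
      using l unfolding preimage[OF S'Q] by simp
    then have "order Q * card K = (card (\<pi> ` S) * l) * card K"
      by (simp only: ac_simps)
    then have "order Q = card (\<pi> ` S) * l"
      using cardK by (metis mult_right_cancel less_numeral_extra(3))
    ultimately show thesis using that by blast
  qed
  moreover have "x \<otimes>\<^bsub>Q\<^esub> y = y \<otimes>\<^bsub>Q\<^esub> x" if "x \<in> \<pi> ` S" "y \<in> \<pi> ` S" for x y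
    using that comm by (auto simp flip: \<pi>.hom_mult)
  moreover have "x [^]\<^bsub>Q\<^esub> p = \<one>\<^bsub>Q\<^esub>" if "x \<in> \<pi> ` S" for x
    using that pow by (auto simp flip: \<pi>.hom_nat_pow)
  ultimately obtain A' where A': "subgroup A' Q" "\<pi> ` M \<inter> A' = {K}"
      "\<pi> ` M <#>\<^bsub>Q\<^esub> A' = carrier Q"
    using Q.prime_normal_subgroup_complement[OF finQ, of "\<pi> ` M" "\<pi> ` S" l] cardM p(1) one_Q by auto
  let ?A = "{x \<in> carrier G. \<pi> x \<in> A'}"
  have A: "subgroup ?A G"
    using subgroup.m_closed[OF A'(1)] subgroup.m_inv_closed[OF A'(1)] subgroup.one_closed[OF A'(1)]
    by (intro subgroupI) (auto simp flip: \<pi>.hom_one)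
  moreover have "K \<subseteq> ?A"
  proof
    fix k assume k: "k \<in> K"
    then have "\<pi> k = \<one>\<^bsub>Q\<^esub>"
      using ker[of k] by (simp add: one_Q)
    then show "k \<in> ?A"
      using k subgroup.one_closed[OF A'(1)] by simp
  qed
  moreover have "?A \<inter> M \<subseteq> K"
  proof
    fix x assume x: "x \<in> ?A \<inter> M"
    then have "\<pi> x \<in> \<pi> ` M \<inter> A'" by blast
    then show "x \<in> K"
      using x ker by (simp add: A'(2))
  qed
  moreover have "M <#> ?A = carrier G"
  proof
    show "M <#> ?A \<subseteq> carrier G" by (auto simp: mem_set_mult)
    show "carrier G \<subseteq> M <#> ?A"
    proof
      fix g assume g: "g \<in> carrier G"
      then have "\<pi> g \<in> \<pi> ` M <#>\<^bsub>Q\<^esub> A'"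
        using A'(3) by simp
      then obtain m a where ma: "m \<in> M" "a \<in> A'" "\<pi> g = \<pi> m \<otimes>\<^bsub>Q\<^esub> a"
        by (auto simp: Q.mem_set_mult)
      have "a \<in> carrier Q" using subgroup.mem_carrier[OF A'(1) ma(2)] .
      have "\<pi> (inv m \<otimes> g) = inv\<^bsub>Q\<^esub> (\<pi> m) \<otimes>\<^bsub>Q\<^esub> (\<pi> m \<otimes>\<^bsub>Q\<^esub> a)"
        using g ma(1,3) by simp
      also have "\<dots> = a"
        using ma(1) \<open>a \<in> carrier Q\<close> by (intro Q.inv_cancel_left) auto
      finally have "inv m \<otimes> g \<in> ?A" using ma(1,2) g by simp
      moreover have "g = m \<otimes> (inv m \<otimes> g)" using ma(1) g by (simp add: inv_cancel_left)
      ultimately show "g \<in> M <#> ?A" using ma(1) unfolding mem_set_mult by blast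
    qed
  qed
  ultimately show ?thesis by blast
qed

section \<open>Complemented series of prime factors\<close>

lemma (in group) rcoset_subset_iff:
  assumes "subgroup H G" "subgroup K G" "x \<in> carrier G"
  shows "K #> x \<subseteq> H #> x \<longleftrightarrow> K \<subseteq> H"
proof
  assume sub: "K #> x \<subseteq> H #> x"
  show "K \<subseteq> H"
  proof
    fix k assume k: "k \<in> K"
    then have "k \<otimes> x \<in> H #> x"
      using sub by (auto simp: r_coset_def)
    then obtain h where h: "h \<in> H" "k \<otimes> x = h \<otimes> x"
      by (auto simp: r_coset_def)
    then have "k = h"
      using k assms by (metis right_cancel subgroup.mem_carrier)
    with h show "k \<in> H" by simp
  qed
qed (auto simp: r_coset_def)

text \<open>All that the combinatorial part knows about \<open>G\<close>. The conditions on
  \<open>A i\<close> say that modulo \<open>N i\<close> it is a complement of the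
  \<open>i\<close>-th factor; complements for different \<open>i\<close> are chosen
  independently.\<close>

locale complemented_series = group +
  fixes N A :: "nat \<Rightarrow> 'a set" and r :: nat
  assumes finite_carrier: "finite (carrier G)"
    and N_0: "N 0 = {\<one>}" and N_r: "N r = carrier G"
    and N_normal: "i \<le> r \<Longrightarrow> N i \<lhd> G"
    and N_Suc: "i < r \<Longrightarrow> N i \<subseteq> N (Suc i)"
    and prime_factor: "i < r \<Longrightarrow> \<exists>p. prime p \<and> card (N (Suc i)) = p * card (N i)"
    and A_subgroup: "i < r \<Longrightarrow> subgroup (A i) G"
    and N_A: "i < r \<Longrightarrow> N i \<subseteq> A i"
    and A_inter_N: "i < r \<Longrightarrow> A i \<inter> N (Suc i) \<subseteq> N i"
    and N_mult_A: "i < r \<Longrightarrow> N (Suc i) <#> A i = carrier G"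
begin

lemma N_subgroup: "i \<le> r \<Longrightarrow> subgroup (N i) G"
  using N_normal normal_imp_subgroup by blast

lemma N_mono: "i \<le> j \<Longrightarrow> j \<le> r \<Longrightarrow> N i \<subseteq> N j"
proof (induction j rule: dec_induct)
  case (step j)
  then show ?case using N_Suc[of j] by auto
qed auto

text \<open>The indices at which the series of subgroups \<open>H \<inter> N i\<close> jumps. As the
  factors have prime order, each of them is either covered or avoided by \<open>H\<close>.\<close>

definition factors :: "'a set \<Rightarrow> nat set" where
  "factors H = {i. i < r \<and> (\<exists>h\<in>H. h \<in> N (Suc i) - N i)}"

lemma factors_mono: "K \<subseteq> H \<Longrightarrow> factors K \<subseteq> factors H"
  by (auto simp: factors_def)

text \<open>The image of \<open>H \<inter> N (Suc i)\<close> in a factor of prime order is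
  nontrivial, hence the whole factor.\<close>

lemma factors_layer:
  assumes H: "subgroup H G" and i: "i \<in> factors H" and g: "g \<in> N (Suc i)"
  shows "\<exists>h\<in>H \<inter> N (Suc i). \<exists>n\<in>N i. g = n \<otimes> h"
proof -
  have ir: "i < r" using i by (simp add: factors_def)
  interpret N0: normal "N i" G using N_normal ir by simp
  interpret N1: normal "N (Suc i)" G using N_normal ir by simp
  let ?H1 = "H \<inter> N (Suc i)" and ?U = "N i <#> (H \<inter> N (Suc i))"
  have H1: "subgroup ?H1 G"
    using H N1.is_subgroup by (rule subgroups_Inter_pair)
  have U: "subgroup ?U G"
    using N0.normal_axioms H1 by (rule mult_norm_subgroup)
  have NU: "N i \<subseteq> ?U"
  proof
    fix x assume "x \<in> N i"
    then show "x \<in> ?U"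
      using subgroup.one_closed[OF H1] N0.subset unfolding mem_set_mult by (metis r_one subsetD)
  qed
  have UN: "?U \<subseteq> N (Suc i)"
    using N_Suc[OF ir] N1.m_closed unfolding set_mult_def by blast
  obtain h where h: "h \<in> H" "h \<in> N (Suc i)" "h \<notin> N i"
    using i by (auto simp: factors_def)
  then have "h \<in> ?U"
    using N0.one_closed N1.subset unfolding mem_set_mult by (metis IntI l_one subsetD)
  have fin: "finite ?U" "finite (N (Suc i))"
    using finite_carrier subgroup.subset[OF U] N1.subset by (auto intro: finite_subset)
  obtain p where p: "prime p" "card (N (Suc i)) = p * card (N i)"
    using prime_factor ir by blast
  obtain k where k: "card ?U = card (N i) * k"
    using card_subgroup_dvd[OF finite_carrier N0.is_subgroup U NU] by (rule dvdE)
  have "card ?U dvd card (N (Suc i))"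
    using finite_carrier U N1.is_subgroup UN by (rule card_subgroup_dvd)
  moreover have "card (N i) < card ?U"
    using fin(1) NU \<open>h \<in> ?U\<close> h(3) by (intro psubset_card_mono) auto
  ultimately have "k dvd p" "k \<noteq> 1"
    unfolding k p(2) by (auto simp: mult.commute)
  then have "k = p"
    using p(1) by (metis prime_nat_iff)
  then have "?U = N (Suc i)"
    using UN fin k p(2) by (intro card_subset_eq) (auto simp: mult.commute)
  with g have "g \<in> ?U" by simp
  then show ?thesis unfolding mem_set_mult by blast
qed

text \<open>Induction along the series: an element of \<open>H \<inter> N (Suc j)\<close> outside
  \<open>N j\<close> agrees modulo \<open>N j\<close> with some element of \<open>K\<close>, and
  their quotient lies in \<open>H \<inter> N j\<close>, where the induction hypothesis
  applies.\<close>

lemma inter_N_subset: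
  assumes H: "subgroup H G" and K: "subgroup K G" and "K \<subseteq> H" and "j \<le> r"
    and "\<And>i. i < j \<Longrightarrow> i \<in> factors H \<Longrightarrow> i \<in> factors K"
  shows "H \<inter> N j \<subseteq> K"
  using assms(4,5)
proof (induction j)
  case 0
  then show ?case using N_0 subgroup.one_closed[OF K] by auto
next
  case (Suc j)
  then have IH: "H \<inter> N j \<subseteq> K" by simp
  show ?case
  proof
    fix h assume h: "h \<in> H \<inter> N (Suc j)"
    show "h \<in> K"
    proof (cases "h \<in> N j")
      case True
      then show ?thesis using IH h by auto
    next
      case False
      with h Suc.prems have "j \<in> factors K"
        by (auto simp: factors_def)
      then obtain k n where kn: "k \<in> K" "n \<in> N j" "h = n \<otimes> k"
        using factors_layer[OF K, of j h] h by auto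
      have G: "k \<in> carrier G" "n \<in> carrier G"
        using kn K N_subgroup[of j] Suc.prems(1) subgroup.mem_carrier by auto
      have "h \<otimes> inv k \<in> H"
        using h kn(1) \<open>K \<subseteq> H\<close> H by (auto intro!: subgroup.m_closed subgroup.m_inv_closed)
      moreover have "h \<otimes> inv k = n"
        using G kn(3) by (simp add: m_assoc)
      ultimately have "n \<in> K" using IH kn(2) by auto
      then show ?thesis using kn K by (auto intro: subgroup.m_closed)
    qed
  qed
qed

lemma subgroup_eqI_factors:
  assumes "subgroup H G" "subgroup K G" "K \<subseteq> H" "factors H = factors K"
  shows "K = H"
  using inter_N_subset[OF assms(1-3), of r] assms N_r subgroup.subset by blast

text \<open>Start from \<open>N_mult_A\<close> and split the part in \<open>N (Suc i)\<close> by
  \<open>factors_layer\<close>. The rest in \<open>N i\<close> passes \<open>h\<close> by normality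
  and is absorbed by \<open>A i\<close>. Consequently every coset of \<open>H\<close> meets
  \<open>A i\<close>.\<close>

lemma factor_subset_A:
  assumes i: "i \<in> factors H" and H: "subgroup H G" and g: "g \<in> carrier G"
  shows "\<exists>h\<in>H \<inter> N (Suc i). \<exists>a\<in>A i. g = h \<otimes> a"
proof -
  have ir: "i < r" using i by (simp add: factors_def)
  interpret N0: normal "N i" G using N_normal ir by simp
  interpret N1: normal "N (Suc i)" G using N_normal ir by simp
  interpret A: subgroup "A i" G using A_subgroup ir by simp
  obtain m a where ma: "m \<in> N (Suc i)" "a \<in> A i" "g = m \<otimes> a"
    using N_mult_A[OF ir] g mem_set_mult by blast
  obtain h n where hn: "h \<in> H \<inter> N (Suc i)" "n \<in> N i" "m = n \<otimes> h"
    using factors_layer[OF H i ma(1)] by blast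
  have G: "h \<in> carrier G" "n \<in> carrier G" "a \<in> carrier G"
    using hn ma by auto
  have "inv h \<otimes> n \<otimes> h \<in> A i"
    using N0.inv_op_closed1[OF G(1) hn(2)] N_A ir by auto
  then have "inv h \<otimes> n \<otimes> h \<otimes> a \<in> A i"
    using ma(2) by simp
  moreover have "g = h \<otimes> (inv h \<otimes> n \<otimes> h \<otimes> a)"
    using G by (simp add: ma(3) hn(3) m_assoc inv_cancel_left)
  ultimately show ?thesis using hn(1) by blast
qed

text \<open>Witnesses for \<open>j < i\<close> lie in \<open>N i\<close>, hence in
  \<open>A i\<close>. A witness for \<open>j > i\<close> is moved into \<open>A i\<close> by an
  element of \<open>H \<inter> N (Suc i)\<close>, which lies in \<open>N j\<close> and so does not
  affect the factor. The factor \<open>i\<close> is lost by \<open>A_inter_N\<close>.\<close>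

lemma factors_inter_A:
  assumes i: "i \<in> factors H" and H: "subgroup H G"
  shows "factors (H \<inter> A i) = factors H - {i}"
proof (intro equalityI subsetI)
  fix j assume "j \<in> factors (H \<inter> A i)"
  then show "j \<in> factors H - {i}"
    using A_inter_N by (auto simp: factors_def)
next
  fix j assume j: "j \<in> factors H - {i}"
  have ir: "i < r" using i by (simp add: factors_def)
  obtain h where h: "h \<in> H" "h \<in> N (Suc j)" "h \<notin> N j" and jr: "j < r"
    using j by (auto simp: factors_def)
  show "j \<in> factors (H \<inter> A i)"
  proof (cases "j < i")
    case True
    then have "h \<in> A i"
      using N_mono[of "Suc j" i] h(2) N_A[OF ir] ir by auto
    then show ?thesis using h jr by (auto simp: factors_def)
  next
    case False
    with j have "i < j" by auto
    have "h \<in> carrier G" using h(1) subgroup.mem_carrier[OF H] by auto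
    then obtain k a where ka: "k \<in> H" "k \<in> N (Suc i)" "a \<in> A i" "h = k \<otimes> a"
      using factor_subset_A[OF i H] by blast
    interpret Nj: subgroup "N j" G using N_subgroup jr by simp
    interpret Nj1: subgroup "N (Suc j)" G using N_subgroup jr by simp
    have k: "k \<in> N j" "k \<in> N (Suc j)"
      using ka(2) N_mono[of "Suc i" j] N_mono[of "Suc i" "Suc j"] \<open>i < j\<close> jr by auto
    have aG: "a \<in> carrier G" using ka(3) subgroup.mem_carrier[OF A_subgroup[OF ir]] by auto
    have a: "a = inv k \<otimes> h"
      using k(1) aG by (simp add: ka(4) inv_cancel_left)
    then have "a \<in> H" "a \<in> N (Suc j)"
      using ka(1) h(1,2) k(2) H by (auto intro: subgroup.m_closed subgroup.m_inv_closed)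
    moreover have "a \<notin> N j"
      using k(1) h(3) unfolding ka(4) by auto
    ultimately show ?thesis using ka(3) jr by (auto simp: factors_def)
  qed
qed

text \<open>Dedekind's law lets the maximal missing factor be removed by the subgroup \<open>(H \<inter> N i) K\<close>,
  which is written here as \<open>H \<inter> N i K\<close>.\<close>

lemma factors_inter_N_mult:
  assumes H: "subgroup H G" and K: "subgroup K G" and KH: "K \<subseteq> H"
    and i: "i \<in> factors H" "i \<notin> factors K"
    and max: "\<And>j. j \<in> factors H \<Longrightarrow> i < j \<Longrightarrow> j \<in> factors K"
  shows "subgroup (H \<inter> (N i <#> K)) G" "K \<subseteq> H \<inter> (N i <#> K)"
    "factors (H \<inter> (N i <#> K)) = factors H - {i}"
proof -
  have ir: "i < r" using i by (simp add: factors_def)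
  interpret N0: normal "N i" G using N_normal ir by simp
  interpret N1: normal "N (Suc i)" G using N_normal ir by simp
  interpret K: subgroup K G by fact
  show "subgroup (H \<inter> (N i <#> K)) G"
    using H mult_norm_subgroup[OF N0.normal_axioms K] by (rule subgroups_Inter_pair)
  show KM: "K \<subseteq> H \<inter> (N i <#> K)"
    using KH N0.one_closed K.subset unfolding set_mult_def by (force intro: bexI[of _ \<one>])
  show "factors (H \<inter> (N i <#> K)) = factors H - {i}"
  proof (intro equalityI subsetI)
    fix j assume j: "j \<in> factors (H \<inter> (N i <#> K))"
    have "j \<noteq> i"
    proof
      assume "j = i"
      then obtain m where m: "m \<in> N i <#> K" "m \<in> N (Suc i)" "m \<notin> N i"
        using j by (auto simp: factors_def)
      then obtain n k where nk: "n \<in> N i" "k \<in> K" "m = n \<otimes> k"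
        unfolding mem_set_mult by blast
      then have "k = inv n \<otimes> m" by (simp add: inv_cancel_left)
      then have "k \<in> N (Suc i)"
        using nk(1) m(2) N_Suc[OF ir] by auto
      moreover have "k \<notin> N i"
        using nk m(3) by auto
      ultimately show False
        using nk(2) i(2) ir by (auto simp: factors_def)
    qed
    then show "j \<in> factors H - {i}"
      using j factors_mono[of "H \<inter> (N i <#> K)" H] by auto
  next
    fix j assume j: "j \<in> factors H - {i}"
    then obtain h where h: "h \<in> H" "h \<in> N (Suc j)" "h \<notin> N j" and jr: "j < r"
      by (auto simp: factors_def)
    show "j \<in> factors (H \<inter> (N i <#> K))"
    proof (cases "j < i")
      case True
      then have "h \<in> N i"
        using N_mono[of "Suc j" i] h(2) ir by auto
      then have "h \<in> N i <#> K"
        using K.one_closed N0.subset unfolding mem_set_mult by (metis r_one subsetD)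
      then show ?thesis using h jr by (auto simp: factors_def)
    next
      case False
      then show ?thesis
        using j max[of j] factors_mono[OF KM] by auto
    qed
  qed
qed

text \<open>\<open>M\<close> has the same factors as \<open>H\<close> below \<open>i\<close>, so it
  contains \<open>H \<inter> N i\<close> and, together with \<open>K\<close>, the whole product.
  Equal factors then force equality.\<close>

lemma inter_N_mult_unique:
  assumes H: "subgroup H G" and K: "subgroup K G" and KH: "K \<subseteq> H"
    and i: "i \<in> factors H" "i \<notin> factors K"
    and max: "\<And>j. j \<in> factors H \<Longrightarrow> i < j \<Longrightarrow> j \<in> factors K"
    and M: "subgroup M G" "K \<subseteq> M" "M \<subseteq> H" "factors H - factors M = {i}"
  shows "M = H \<inter> (N i <#> K)"
proof -
  have ir: "i < r" using i by (simp add: factors_def)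
  interpret N0: normal "N i" G using N_normal ir by simp
  note HNK = factors_inter_N_mult[OF H K KH i max]
  have sub: "H \<inter> N i \<subseteq> M"
    using M ir by (intro inter_N_subset[OF H]) auto
  have "H \<inter> (N i <#> K) \<subseteq> M"
  proof
    fix m assume m: "m \<in> H \<inter> (N i <#> K)"
    then obtain n k where nk: "n \<in> N i" "k \<in> K" "m = n \<otimes> k"
      unfolding Int_iff mem_set_mult by blast
    have "n = m \<otimes> inv k"
      using nk K subgroup.mem_carrier[OF K] by (simp add: m_assoc)
    moreover have "m \<otimes> inv k \<in> H"
      using m nk(2) KH H by (auto intro!: subgroup.m_closed subgroup.m_inv_closed)
    ultimately have "n \<in> M" using sub nk(1) by auto
    then show "m \<in> M" using nk M by (auto intro: subgroup.m_closed)
  qed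
  moreover have "factors M = factors (H \<inter> (N i <#> K))"
    using HNK(3) M(4) factors_mono[OF M(3)] by auto
  ultimately show ?thesis
    using subgroup_eqI_factors[OF M(1) HNK(1)] by auto
qed

section \<open>Cosets and their factors\<close>

definition coset :: "'a set \<Rightarrow> bool" where
  "coset X \<longleftrightarrow> (\<exists>H x. subgroup H G \<and> x \<in> carrier G \<and> X = H #> x)"

text \<open>For a right coset of \<open>H\<close> the quotients \<open>a \<otimes> inv b\<close>
  range over \<open>H\<close>. Thus no subgroup has to be chosen, monotonicity is immediate, and the
  empty set has no factors.\<close>

definition coset_factors :: "'a set \<Rightarrow> nat set" where
  "coset_factors X = {i. i < r \<and> (\<exists>a\<in>X. \<exists>b\<in>X. a \<otimes> inv b \<in> N (Suc i) - N i)}"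

lemma coset_factors_rcoset:
  assumes H: "subgroup H G" and x: "x \<in> carrier G"
  shows "coset_factors (H #> x) = factors H"
proof (intro equalityI subsetI)
  interpret H: subgroup H G by fact
  fix i
  {
    assume i: "i \<in> coset_factors (H #> x)"
    then obtain a b where ab: "a \<in> H" "b \<in> H" "(a \<otimes> x) \<otimes> inv (b \<otimes> x) \<in> N (Suc i) - N i"
      by (auto simp: coset_factors_def r_coset_def)
    moreover have "(a \<otimes> x) \<otimes> inv (b \<otimes> x) = a \<otimes> inv b"
      using ab(1,2) x by (simp add: m_assoc inv_mult_group inv_cancel_left)
    ultimately have "a \<otimes> inv b \<in> H" "a \<otimes> inv b \<in> N (Suc i) - N i"
      by auto
    then show "i \<in> factors H"
      using i by (auto simp: factors_def coset_factors_def)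
  }
  {
    assume i: "i \<in> factors H"
    then obtain h where h: "h \<in> H" "h \<in> N (Suc i) - N i"
      by (auto simp: factors_def)
    have "(h \<otimes> x) \<otimes> inv x = h"
      using h x by (simp add: m_assoc)
    moreover have "h \<otimes> x \<in> H #> x" "x \<in> H #> x"
      using h(1) x rcos_self[OF x H] by (auto simp: r_coset_def)
    moreover have "i < r" using i by (simp add: factors_def)
    ultimately show "i \<in> coset_factors (H #> x)"
      using h(2) unfolding coset_factors_def by force
  }
qed

lemma coset_factors_mono: "Y \<subseteq> X \<Longrightarrow> coset_factors Y \<subseteq> coset_factors X"
  by (auto simp: coset_factors_def)

lemma coset_factors_empty [simp]: "coset_factors {} = {}"
  by (simp add: coset_factors_def)

lemma coset_factors_bound: "i \<in> coset_factors X \<Longrightarrow> i < r"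
  by (simp add: coset_factors_def)

lemma finite_coset_factors [simp]: "finite (coset_factors X)"
  by (simp add: coset_factors_def)

lemma coset_subset: "coset X \<Longrightarrow> X \<subseteq> carrier G"
  using r_coset_subset_G subgroup.subset unfolding coset_def by blast

lemma coset_nonempty: "coset X \<Longrightarrow> X \<noteq> {}"
  using rcos_self unfolding coset_def by blast

lemma coset_at:
  assumes "coset X" "x \<in> X"
  shows "\<exists>H. subgroup H G \<and> X = H #> x"
  using assms repr_independence[of x] unfolding coset_def by metis

lemma coset_pair:
  assumes X: "coset X" and Y: "coset Y" and YX: "Y \<subseteq> X"
  obtains H K x where "subgroup H G" "subgroup K G" "K \<subseteq> H" "x \<in> carrier G"
    "X = H #> x" "Y = K #> x" "x \<in> Y"
proof -
  obtain x where x: "x \<in> Y" using coset_nonempty[OF Y] by blast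
  have xG: "x \<in> carrier G" using coset_subset[OF Y] x by blast
  obtain K where K: "subgroup K G" "Y = K #> x" using coset_at[OF Y x] by blast
  obtain H where H: "subgroup H G" "X = H #> x" using coset_at[OF X] YX x by blast
  show thesis
    using that[OF H(1) K(1) _ xG H(2) K(2) x] rcoset_subset_iff[OF H(1) K(1) xG] YX H(2) K(2) by simp
qed

lemma coset_eqI_factors:
  assumes "coset X" "coset Y" "Y \<subseteq> X" "coset_factors X = coset_factors Y"
  shows "X = Y"
proof -
  obtain H K x where *: "subgroup H G" "subgroup K G" "K \<subseteq> H" "x \<in> carrier G" "X = H #> x" "Y = K #> x"
    using coset_pair[OF assms(1-3)] by metis
  then have "factors H = factors K"
    using assms(4) by (simp add: coset_factors_rcoset)
  then show ?thesis using subgroup_eqI_factors[OF *(1-3)] * by simp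
qed

text \<open>By \<open>factor_subset_A\<close> the coset contains some \<open>a \<in> A i\<close>.
  With \<open>a\<close> as representative, the intersection is the coset of
  \<open>H \<inter> A i\<close> through \<open>a\<close>.\<close>

lemma coset_inter_A:
  assumes X: "coset X" and i: "i \<in> coset_factors X"
  shows "coset (X \<inter> A i)" "coset_factors (X \<inter> A i) = coset_factors X - {i}"
proof -
  have ir: "i < r" using i by (rule coset_factors_bound)
  interpret A: subgroup "A i" G using A_subgroup ir by simp
  obtain H x where H: "subgroup H G" and x: "x \<in> carrier G" and X_eq: "X = H #> x"
    using X by (auto simp: coset_def)
  interpret H: subgroup H G by fact
  have iH: "i \<in> factors H" using i H x X_eq by (simp add: coset_factors_rcoset)
  obtain h a where ha: "h \<in> H" "a \<in> A i" "x = h \<otimes> a"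
    using factor_subset_A[OF iH H x] by blast
  then have "a = inv h \<otimes> x" by (simp add: inv_cancel_left)
  then have "a \<in> X" using ha(1) unfolding X_eq r_coset_def by blast
  have aG: "a \<in> carrier G" using ha(2) by simp
  have X_a: "X = H #> a"
    using repr_independence[OF _ x H] \<open>a \<in> X\<close> X_eq by simp
  have "X \<inter> A i = (H \<inter> A i) #> a"
  proof (intro equalityI subsetI)
    fix y assume "y \<in> X \<inter> A i"
    then obtain k where k: "k \<in> H" "y = k \<otimes> a" "y \<in> A i"
      unfolding X_a r_coset_def by blast
    then have "k = y \<otimes> inv a" using aG by (simp add: m_assoc)
    then have "k \<in> A i" using k(3) ha(2) by auto
    then show "y \<in> (H \<inter> A i) #> a" using k unfolding r_coset_def by blast
  qed (use ha(2) in \<open>auto simp: X_a r_coset_def\<close>)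
  moreover have HA: "subgroup (H \<inter> A i) G"
    using H A.is_subgroup by (rule subgroups_Inter_pair)
  ultimately show "coset (X \<inter> A i)" "coset_factors (X \<inter> A i) = coset_factors X - {i}"
    using factors_inter_A[OF iH H] aG H
    by (auto simp: coset_def coset_factors_rcoset X_a)
qed

text \<open>The two preceding results on \<open>H \<inter> (N i <#> K)\<close>, translated by
  \<open>x\<close>. The clause on \<open>A i\<close> holds because \<open>A i\<close> absorbs
  \<open>N i\<close>; it shows that if the largest missing factor can be removed specially, its only
  removal above \<open>Y\<close> is special.\<close>

lemma coset_remove_max:
  assumes X: "coset X" and Y: "coset Y" and YX: "Y \<subseteq> X"
    and i: "i \<in> coset_factors X - coset_factors Y"
    and max: "\<And>j. j \<in> coset_factors X \<Longrightarrow> i < j \<Longrightarrow> j \<in> coset_factors Y"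
  shows "\<exists>Z. coset Z \<and> Y \<subseteq> Z \<and> Z \<subseteq> X \<and> coset_factors Z = coset_factors X - {i} \<and>
    (Y \<subseteq> A i \<longrightarrow> Z \<subseteq> A i) \<and>
    (\<forall>W. coset W \<and> Y \<subseteq> W \<and> W \<subseteq> X \<and> coset_factors X - coset_factors W = {i} \<longrightarrow> W = Z)"
proof -
  have ir: "i < r" using i by (auto intro: coset_factors_bound)
  interpret A: subgroup "A i" G using A_subgroup ir by simp
  obtain H K x where H: "subgroup H G" and K: "subgroup K G" and KH: "K \<subseteq> H" and x: "x \<in> carrier G"
    and X_eq: "X = H #> x" and Y_eq: "Y = K #> x" and "x \<in> Y"
    using coset_pair[OF X Y YX] .
  interpret K: subgroup K G by fact
  let ?M = "H \<inter> (N i <#> K)"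
  have iH: "i \<in> factors H" "i \<notin> factors K"
    and maxH: "\<And>j. j \<in> factors H \<Longrightarrow> i < j \<Longrightarrow> j \<in> factors K"
    using i max H K x by (auto simp: X_eq Y_eq coset_factors_rcoset)
  note M = factors_inter_N_mult[OF H K KH iH maxH]
  have "?M #> x \<subseteq> A i" if YA: "Y \<subseteq> A i"
  proof
    fix y assume "y \<in> ?M #> x"
    then obtain m where m: "m \<in> N i <#> K" "y = m \<otimes> x" unfolding r_coset_def by blast
    then obtain n k where nk: "n \<in> N i" "k \<in> K" "m = n \<otimes> k" unfolding mem_set_mult by blast
    have "k \<otimes> x \<in> A i" using nk(2) YA unfolding Y_eq r_coset_def by blast
    moreover have "n \<in> A i" using nk(1) N_A[OF ir] by blast
    moreover have "y = n \<otimes> (k \<otimes> x)"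
      using nk m(2) x \<open>n \<in> A i\<close> by (simp add: m_assoc)
    ultimately show "y \<in> A i" by simp
  qed
  moreover have "W = ?M #> x"
    if W: "coset W" "Y \<subseteq> W" "W \<subseteq> X" "coset_factors X - coset_factors W = {i}" for W
  proof -
    obtain U where U: "subgroup U G" "W = U #> x"
      using coset_at[OF W(1)] W(2) \<open>x \<in> Y\<close> by blast
    have "K \<subseteq> U" "U \<subseteq> H"
      using W(2,3) rcoset_subset_iff[OF U(1) K x] rcoset_subset_iff[OF H U(1) x]
      by (simp_all add: U(2) X_eq Y_eq)
    moreover have "factors H - factors U = {i}"
      using W(4) H U x by (simp add: X_eq coset_factors_rcoset)
    ultimately have "U = ?M"
      using inter_N_mult_unique[OF H K KH iH maxH U(1)] by blast
    then show ?thesis using U(2) by simp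
  qed
  moreover have "coset (?M #> x)"
    using M(1) x by (auto simp: coset_def)
  moreover have "Y \<subseteq> ?M #> x" "?M #> x \<subseteq> X"
    using M(1,2) H K x by (simp_all add: rcoset_subset_iff X_eq Y_eq)
  moreover have "coset_factors (?M #> x) = coset_factors X - {i}"
    using M H x by (simp add: coset_factors_rcoset X_eq)
  ultimately show ?thesis by blast
qed

section \<open>The lattice of cosets, its covers and their labels\<close>

sublocale lattice: finite_poset "\<lambda>X Y :: 'a set. Y \<subseteq> X" "\<lambda>X Y. Y \<subset> X" "insert {} (Collect coset)"
proof
  have "Collect coset \<subseteq> Pow (carrier G)"
    using coset_subset by blast
  then show "finite (insert {} (Collect coset))"
    using finite_carrier by (simp add: finite_subset)
qed

abbreviation covers :: "'a set \<Rightarrow> 'a set \<Rightarrow> bool" where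
  "covers \<equiv> lattice.covers"

text \<open>Removing the largest missing factor gives a coset between \<open>X\<close> and
  \<open>Y\<close> different from \<open>X\<close>; for a cover it must be \<open>Y\<close>.\<close>

lemma covers_coset:
  assumes XY: "covers X Y" and "Y \<noteq> {}"
  shows "\<exists>i. coset X \<and> coset Y \<and> Y \<subset> X \<and> i < r \<and> i \<in> coset_factors X \<and>
    coset_factors Y = coset_factors X - {i} \<and> coset_factors X - coset_factors Y = {i}"
proof -
  have X: "coset X" and Y: "coset Y" and YX: "Y \<subset> X"
    and cover: "\<And>Z. coset Z \<Longrightarrow> Z \<subset> X \<Longrightarrow> \<not> Y \<subset> Z"
    using assms by (auto simp: lattice.covers_def)
  let ?D = "coset_factors X - coset_factors Y"
  have "?D \<noteq> {}"
    using coset_eqI_factors[OF X Y] coset_factors_mono[of Y X] YX by blast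
  then have D: "Max ?D \<in> ?D" by (intro Max_in) auto
  have "j \<in> coset_factors Y" if "j \<in> coset_factors X" "Max ?D < j" for j
    using Max_ge[of ?D j] that by fastforce
  then obtain Z where Z: "coset Z" "Y \<subseteq> Z" "Z \<subseteq> X" "coset_factors Z = coset_factors X - {Max ?D}"
    using coset_remove_max[OF X Y _ D] YX by (metis (no_types, lifting) psubset_imp_subset)
  have "Z \<noteq> X" using Z(4) D by blast
  then have "Y = Z" using cover[OF Z(1)] Z(2,3) by blast
  then show ?thesis
    using X Y YX D Z(4) coset_factors_bound by blast
qed

text \<open>A coset strictly in between would have the factors of one of the two ends, hence be
  equal to it.\<close>

lemma coversI_factors:
  assumes X: "coset X" and Z: "coset Z" and "Z \<subseteq> X" "coset_factors X - coset_factors Z = {i}"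
  shows "covers X Z"
proof -
  have "\<not> (W \<subset> X \<and> Z \<subset> W)" if W: "coset W" for W
  proof
    assume WX: "W \<subset> X \<and> Z \<subset> W"
    then have "coset_factors Z \<subseteq> coset_factors W" "coset_factors W \<subseteq> coset_factors X"
      by (simp_all add: coset_factors_mono psubset_imp_subset)
    moreover have "j \<in> coset_factors Z \<or> j = i" if "j \<in> coset_factors X" for j
      using assms(4) that by blast
    ultimately have "coset_factors W = coset_factors Z \<or> coset_factors X = coset_factors W"
      by (metis equalityI subsetD subsetI)
    then show False
      using coset_eqI_factors[OF X W] coset_eqI_factors[OF W Z] WX by blast
  qed
  moreover have "Z \<subset> X" using assms(3,4) by blast
  ultimately show ?thesis
    using X Z coset_nonempty[OF Z] by (auto simp: lattice.covers_def)
qed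

lemma covers_inter_A:
  assumes "coset X" "i \<in> coset_factors X"
  shows "covers X (X \<inter> A i)"
  using assms coset_inter_A[OF assms] by (intro coversI_factors) auto

lemma covers_subset_A:
  assumes "covers X Y" "Y \<noteq> {}" "Y \<subseteq> A i" "i \<in> coset_factors X"
  shows "Y = X \<inter> A i"
proof -
  have X: "coset X" and YX: "Y \<subset> X" using covers_coset[OF assms(1,2)] by blast+
  have "X \<inter> A i \<subset> X" using covers_inter_A[OF X assms(4)] by (simp add: lattice.covers_def)
  then show ?thesis
    using assms(1,3) YX coset_inter_A(1)[OF X assms(4)] unfolding lattice.covers_def by blast
qed

text \<open>For a cover with \<open>Y \<noteq> {}\<close> the set under \<open>Max\<close> is a singleton, and \<open>Y \<subseteq> A i\<close> forces
  \<open>Y = X \<inter> A i\<close>.\<close>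

definition label :: "'a set \<Rightarrow> 'a set \<Rightarrow> int" where
  "label X Y = (if Y = {} then 0 else
     let i = Max (coset_factors X - coset_factors Y)
     in if Y \<subseteq> A i then - int i - 1 else int r - int i)"

text \<open>The smallest label of a cover leading from \<open>X\<close> towards \<open>Y\<close>.
  For \<open>Y = {}\<close> every factor is special, so \<open>S = D\<close>; for
  \<open>Y \<subset> X\<close> the final \<open>0\<close> occurs exactly when \<open>X\<close> has
  no factors and \<open>Y\<close> is empty.\<close>

definition min_label :: "'a set \<Rightarrow> 'a set \<Rightarrow> int" where
  "min_label X Y =
     (let D = coset_factors X - coset_factors Y; S = {i\<in>D. Y \<subseteq> A i}
      in if S \<noteq> {} then - int (Max S) - 1 else if D \<noteq> {} then int r - int (Max D) else 0)"

lemma label_eq: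
  "Y \<noteq> {} \<Longrightarrow> coset_factors X - coset_factors Y = {i} \<Longrightarrow>
    label X Y = (if Y \<subseteq> A i then - int i - 1 else int r - int i)"
  by (simp add: label_def)

lemma first_cover_min_label:
  assumes X: "coset X" and Y: "Y = {} \<or> coset Y" and YX: "Y \<subset> X"
  shows "\<exists>Z. lattice.first_cover label X Y Z \<and> label X Z = min_label X Y"
proof -
  define D where "D = coset_factors X - coset_factors Y"
  define S where "S = {i\<in>D. Y \<subseteq> A i}"
  have fin: "finite D" "finite S" by (auto simp: D_def S_def)
  have SD: "S \<subseteq> D" by (auto simp: S_def)
  have min: "min_label X Y =
      (if S \<noteq> {} then - int (Max S) - 1 else if D \<noteq> {} then int r - int (Max D) else 0)"
    by (simp only: min_label_def D_def S_def Let_def)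
  have cover_factor: "\<exists>j\<in>D. j < r \<and> coset W \<and> coset_factors X - coset_factors W = {j} \<and>
      label X W = (if W \<subseteq> A j then - int j - 1 else int r - int j) \<and> (W \<subseteq> A j \<longrightarrow> j \<in> S)"
    if W: "covers X W" "Y \<subseteq> W" "W \<noteq> {}" for W
  proof -
    obtain j where j: "coset W" "j < r" "coset_factors X - coset_factors W = {j}"
      using covers_coset[OF W(1,3)] by blast
    moreover have "j \<in> D"
      using j(3) coset_factors_mono[OF W(2)] by (auto simp: D_def)
    ultimately show ?thesis
      using label_eq[OF W(3) j(3)] W(2) by (auto simp: S_def)
  qed
  consider (special) "S \<noteq> {}" | (other) "S = {}" "D \<noteq> {}" | (empty) "D = {}" by blast
  then show ?thesis
  proof cases
    case special
    \<comment> \<open>A special cover removing a smaller index has a larger label, and any other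
      cover removing \<open>i\<close> is not contained in \<open>A i\<close>, so its label is
      positive.\<close>
    define i where "i = Max S"
    have iS: "i \<in> S" and i_max: "\<And>j. j \<in> S \<Longrightarrow> j \<le> i"
      using special fin by (auto simp: i_def)
    then have iX: "i \<in> coset_factors X" and YA: "Y \<subseteq> A i" by (auto simp: S_def D_def)
    let ?Z = "X \<inter> A i"
    have cov: "covers X ?Z" using X iX by (rule covers_inter_A)
    have ne: "?Z \<noteq> {}" using coset_inter_A(1)[OF X iX] coset_nonempty by blast
    have lab: "label X ?Z = - int i - 1"
      using label_eq[OF ne, of X i] coset_inter_A(2)[OF X iX] iX by auto
    have "label X ?Z < label X W" if W: "covers X W" "Y \<subseteq> W" "W \<noteq> ?Z" for W
    proof (cases "W = {}")
      case True
      then show ?thesis by (simp add: lab) (simp add: label_def)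
    next
      case False
      obtain j where j: "j \<in> D" "j < r" "label X W = (if W \<subseteq> A j then - int j - 1 else int r - int j)"
          "W \<subseteq> A j \<longrightarrow> j \<in> S"
        using cover_factor[OF W(1,2) False] by blast
      have "W = ?Z" if "W \<subseteq> A i"
        using covers_subset_A[OF W(1) False that iX] .
      then show ?thesis
        using j i_max[of j] W(3) by (cases "j = i") (auto simp: lab)
    qed
    then show ?thesis
      using cov YA YX lab special
      by (intro exI[of _ ?Z]) (auto simp: lattice.first_cover_def min i_def)
  next
    case other
    then have Yne: "Y \<noteq> {}" by (auto simp: S_def)
    then have cY: "coset Y" using Y by blast
    \<comment> \<open>No special cover lies above \<open>Y\<close>, as it would make its index an
      element of \<open>S\<close>. So all labels are positive, and the smallest belongs to the
      largest factor, whose removal is unique.\<close>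
    define i where "i = Max D"
    have iD: "i \<in> D" and i_max: "\<And>j. j \<in> D \<Longrightarrow> j \<le> i"
      using other(2) fin by (auto simp: i_def)
    have "j \<in> coset_factors Y" if "j \<in> coset_factors X" "i < j" for j
      using i_max[of j] that by (auto simp: D_def)
    then obtain Z where Z: "coset Z" "Y \<subseteq> Z" "Z \<subseteq> X" "coset_factors Z = coset_factors X - {i}"
      and unique: "\<And>W. coset W \<Longrightarrow> Y \<subseteq> W \<Longrightarrow> W \<subseteq> X \<Longrightarrow>
        coset_factors X - coset_factors W = {i} \<Longrightarrow> W = Z"
      using coset_remove_max[OF X cY, of i] YX iD unfolding D_def
      by (metis (no_types, lifting) psubset_imp_subset)
    have diff: "coset_factors X - coset_factors Z = {i}"
      using Z(4) iD by (auto simp: D_def)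
    have cov: "covers X Z" using X Z(1,3) diff by (rule coversI_factors)
    have "\<not> Z \<subseteq> A i" using iD other(1) Z(2) by (auto simp: S_def)
    then have lab: "label X Z = int r - int i"
      using label_eq[OF coset_nonempty[OF Z(1)] diff] by simp
    have "label X Z < label X W" if W: "covers X W" "Y \<subseteq> W" "W \<noteq> Z" for W
    proof -
      have "W \<noteq> {}" using W(2) Yne by blast
      then obtain j where j: "j \<in> D" "coset W" "coset_factors X - coset_factors W = {j}"
          "label X W = (if W \<subseteq> A j then - int j - 1 else int r - int j)" "W \<subseteq> A j \<longrightarrow> j \<in> S"
        using cover_factor[OF W(1,2)] by blast
      have "W \<subseteq> X" using W(1) by (auto simp: lattice.covers_def)
      then have "j \<noteq> i"
        using unique[OF j(2) W(2)] j(3) W(3) by blast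
      then show ?thesis
        using j other(1) i_max[OF j(1)] by (auto simp: lab)
    qed
    then show ?thesis
      using cov Z(2) lab other
      by (intro exI[of _ Z]) (auto simp: lattice.first_cover_def min i_def)
  next
    case empty
    have "Y = {}"
      using Y YX coset_eqI_factors[OF X, of Y] coset_factors_mono[of Y X] empty by (auto simp: D_def)
    \<comment> \<open>A coset without factors is a minimal coset, so the only step left is the one
      to \<open>\<emptyset>\<close>.\<close>
    have no_coset: "\<not> W \<subset> X" if "coset W" for W
    proof
      assume "W \<subset> X"
      moreover have "coset_factors X = coset_factors W"
        using empty \<open>Y = {}\<close> coset_factors_mono[of W X] \<open>W \<subset> X\<close> by (auto simp: D_def)
      ultimately show False using coset_eqI_factors[OF X that] by blast
    qed
    then have "covers X {}"
      using X YX by (auto simp: lattice.covers_def)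
    moreover have "W = {}" if "covers X W" for W
      using that no_coset by (auto simp: lattice.covers_def)
    moreover have "label X {} = min_label X Y"
      using empty SD by (simp add: min label_def)
    ultimately show ?thesis
      using \<open>Y = {}\<close> by (intro exI[of _ "{}"]) (auto simp: lattice.first_cover_def)
  qed
qed

lemma first_cover_label:
  assumes "coset X" "Y = {} \<or> coset Y" "Y \<subset> X" "lattice.first_cover label X Y Z"
  shows "label X Z = min_label X Y"
proof -
  obtain Z' where Z': "lattice.first_cover label X Y Z'" "label X Z' = min_label X Y"
    using first_cover_min_label[OF assms(1-3)] by blast
  have "Z' = Z"
  proof (rule ccontr)
    assume "Z' \<noteq> Z"
    then have "label X Z' < label X Z" "label X Z < label X Z'"
      using Z'(1) assms(4) unfolding lattice.first_cover_def by blast+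
    then show False by simp
  qed
  then show ?thesis using Z' by simp
qed

lemma first_cover_iff_le:
  assumes "coset X" "Y = {} \<or> coset Y" "Y \<subset> X" "covers X Z" "Y \<subseteq> Z"
  shows "lattice.first_cover label X Y Z \<longleftrightarrow> label X Z \<le> min_label X Y"
proof
  assume "label X Z \<le> min_label X Y"
  moreover obtain Z' where Z': "lattice.first_cover label X Y Z'" "label X Z' = min_label X Y"
    using first_cover_min_label[OF assms(1-3)] by blast
  ultimately have "Z = Z'"
    using assms(4,5) unfolding lattice.first_cover_def by fastforce
  then show "lattice.first_cover label X Y Z" using Z' by simp
qed (use first_cover_label[OF assms(1-3)] in simp)

text \<open>Removing \<open>i\<close> deletes it from \<open>D\<close> and \<open>S\<close>. For a
  special \<open>Z\<close> both sides say that \<open>i\<close> is the maximum of \<open>S\<close>;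
  for a nonspecial one both say that \<open>S\<close> is empty and \<open>i\<close> is the maximum
  of \<open>D\<close>.\<close>

lemma first_cover_iff_min_label_less:
  assumes X: "coset X" and Z: "coset Z" and Y: "Y = {} \<or> coset Y" and YZ: "Y \<subset> Z" and XZ: "covers X Z"
  shows "lattice.first_cover label X Y Z \<longleftrightarrow> label X Z < min_label Z Y"
proof -
  have Zne: "Z \<noteq> {}" using YZ by blast
  obtain i where i: "Z \<subset> X" "i < r" "i \<in> coset_factors X"
      "coset_factors Z = coset_factors X - {i}" "coset_factors X - coset_factors Z = {i}"
    using covers_coset[OF XZ Zne] by blast
  define D where "D = coset_factors X - coset_factors Y"
  define S where "S = {j\<in>D. Y \<subseteq> A j}"
  have fin: "finite D" "finite S" by (auto simp: D_def S_def)
  have bound: "\<And>j. j \<in> D \<Longrightarrow> j < r" using coset_factors_bound by (auto simp: D_def)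
  have SD: "S \<subseteq> D" by (auto simp: S_def)
  have iD: "i \<in> D" using i coset_factors_mono[of Y Z] YZ by (auto simp: D_def)
  have "min_label X Y = (if S \<noteq> {} then - int (Max S) - 1 else if D \<noteq> {} then int r - int (Max D) else 0)"
    by (simp only: min_label_def D_def S_def Let_def)
  then have minX: "min_label X Y = (if S \<noteq> {} then - int (Max S) - 1 else int r - int (Max D))"
    using iD by auto
  have diff: "coset_factors Z - coset_factors Y = D - {i}"
    using i(4) by (auto simp: D_def)
  have special: "{j \<in> D - {i}. Y \<subseteq> A j} = S - {i}" by (auto simp: S_def)
  have minZ: "min_label Z Y = (if S - {i} \<noteq> {} then - int (Max (S - {i})) - 1
      else if D - {i} \<noteq> {} then int r - int (Max (D - {i})) else 0)"
    by (simp only: min_label_def Let_def diff special)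
  have lab: "label X Z = (if Z \<subseteq> A i then - int i - 1 else int r - int i)"
    using label_eq[OF Zne i(5)] .
  have Max_remove: "Max (T - {i}) < i \<longleftrightarrow> Max T = i" if "finite T" "i \<in> T" "T - {i} \<noteq> {}" for T
  proof -
    have "Max T = max i (Max (T - {i}))"
      using that Max.remove[of T i] by simp
    moreover have "Max (T - {i}) \<noteq> i"
      using that Max_in[of "T - {i}"] by auto
    ultimately show ?thesis by auto
  qed
  have YX: "Y \<subset> X" using YZ i(1) by blast
  have iff: "lattice.first_cover label X Y Z \<longleftrightarrow> label X Z \<le> min_label X Y"
    using X Y YX XZ YZ by (intro first_cover_iff_le) auto
  show ?thesis
  proof (cases "Z \<subseteq> A i")
    case True
    then have iS: "i \<in> S" using YZ iD by (auto simp: S_def)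
    show ?thesis
    proof (cases "S - {i} = {}")
      case True
      then have "S = {i}" using iS by blast
      \<comment> \<open>Once the last special index is gone, the minimal label is \<open>0\<close>
        or \<open>r\<close> minus an index below \<open>r\<close>.\<close>
      moreover have "Max (D - {i}) < r" if "D - {i} \<noteq> {}"
        using Max_in[of "D - {i}"] that bound fin(1) by (metis DiffD1 finite_Diff)
      then have "min_label Z Y \<ge> 0"
        using True unfolding minZ by (cases "D - {i} = {}") simp_all
      ultimately show ?thesis
        using \<open>Z \<subseteq> A i\<close> by (auto simp: iff lab minX)
    next
      case False
      have "i \<le> Max S" using fin iS by auto
      then show ?thesis
        using False iS Max_remove[OF fin(2) iS False] \<open>Z \<subseteq> A i\<close> by (auto simp: iff lab minX minZ)
    qed
  next
    case False
    \<comment> \<open>Here the labels would ascend although \<open>Z\<close> is not greedy. It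
      cannot happen: the removal of the largest factor is unique above \<open>Y\<close>, and it
      stays inside \<open>A i\<close> if \<open>Y\<close> does.\<close>
    have "\<not> (S = {i} \<and> D - {i} \<noteq> {} \<and> Max D = i)"
    proof
      assume *: "S = {i} \<and> D - {i} \<noteq> {} \<and> Max D = i"
      then have "Y \<noteq> {}" by (auto simp: S_def)
      then have cY: "coset Y" using Y by blast
      have "j \<in> coset_factors Y" if "j \<in> coset_factors X" "i < j" for j
      proof (rule ccontr)
        assume "j \<notin> coset_factors Y"
        then have "j \<in> D" using that by (simp add: D_def)
        then show False using Max_ge[OF fin(1), of j] * that(2) by linarith
      qed
      moreover have "Y \<subseteq> A i" using * by (auto simp: S_def)
      ultimately have "Z \<subseteq> A i"
        using coset_remove_max[OF X cY _ iD[unfolded D_def]] YX YZ Z i(1,5)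
        by (metis (no_types, lifting) psubset_imp_subset)
      with False show False ..
    qed
    \<comment> \<open>If \<open>i\<close> was the last factor, \<open>Y\<close> is strictly below
      \<open>Z\<close> without losing a factor, hence empty and contained in
      \<open>A i\<close>.\<close>
    moreover have "S \<noteq> {}" if "D - {i} = {}"
    proof -
      have "coset_factors Z \<subseteq> coset_factors Y"
        using that i(4) by (auto simp: D_def)
      then have "Y = {}"
        using coset_eqI_factors[OF Z, of Y] coset_factors_mono[of Y Z] Y YZ by blast
      then show ?thesis using iD by (auto simp: S_def)
    qed
    moreover have "i \<le> Max D" using fin iD by auto
    ultimately show ?thesis
      using False iD i(2) Max_remove[OF fin(1) iD] SD
      by (cases "S = {}"; cases "S = {i}"; cases "D - {i} = {}") (auto simp: iff lab minX minZ)
  qed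
qed

sublocale lattice: bounded_greedy_labeling "\<lambda>X Y :: 'a set. Y \<subseteq> X" "\<lambda>X Y. Y \<subset> X"
  "insert {} (Collect coset)" label "carrier G" "{}"
proof
  have top: "coset (carrier G)"
    using subgroup_self one_closed coset_mult_one[of "carrier G"] by (auto simp: coset_def intro!: exI)
  show "\<exists>Z. lattice.first_cover label X Y Z"
    if "X \<in> insert {} (Collect coset)" "Y \<in> insert {} (Collect coset)" "Y \<subset> X" for X Y
    using that first_cover_min_label[of X Y] by auto
  show "lattice.first_cover label X Y Z \<longleftrightarrow> label X Z < label Z W"
    if Y: "Y \<in> insert {} (Collect coset)" and YZ: "Y \<subset> Z" and XZ: "covers X Z"
      and W: "lattice.first_cover label Z Y W" for X Y Z W
  proof -
    have "coset X" "coset Z" using XZ YZ by (auto simp: lattice.covers_def)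
    then show ?thesis
      using first_cover_iff_min_label_less[of X Z Y] first_cover_label[of Z Y W] Y YZ XZ W by auto
  qed
  show "carrier G \<in> insert {} (Collect coset)" "{} \<in> insert {} (Collect coset)" "carrier G \<noteq> {}"
    using top one_closed by auto
  show "X \<subseteq> carrier G" if "X \<in> insert {} (Collect coset)" for X
    using that coset_subset by auto
qed auto

section \<open>The coset lattice and the coset poset\<close>

lemma proper_cosets_eq: "proper_cosets G = insert {} (Collect coset) - {carrier G, {}}"
proof (intro equalityI subsetI)
  fix X assume "X \<in> proper_cosets G"
  then obtain H x where H: "subgroup H G" "H \<subset> carrier G" and x: "x \<in> carrier G" and X: "X = H #> x"
    by (auto simp: proper_cosets_def)
  then have cX: "coset X" by (auto simp: coset_def)
  have "X \<noteq> carrier G"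
  proof
    assume "X = carrier G"
    then have "carrier G #> x \<subseteq> H #> x"
      using x r_coset_subset_G[of "carrier G" x] by (simp add: X)
    then show False
      using H rcoset_subset_iff[OF H(1) subgroup_self x] by blast
  qed
  then show "X \<in> insert {} (Collect coset) - {carrier G, {}}"
    using cX coset_nonempty by blast
next
  fix X assume X: "X \<in> insert {} (Collect coset) - {carrier G, {}}"
  then obtain H x where H: "subgroup H G" "x \<in> carrier G" "X = H #> x"
    by (auto simp: coset_def)
  have "H \<noteq> carrier G"
    using X H coset_join2[of x "carrier G"] subgroup_self by auto
  then show "X \<in> proper_cosets G"
    using H subgroup.subset[OF H(1)] unfolding proper_cosets_def by blast
qed

lemma coset_lattice_eq: "coset_lattice G = inclusion_order (insert {} (Collect coset))"
  using lattice.ends by (auto simp: coset_lattice_def proper_cosets_eq)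

theorem coEL_shellable_coset_lattice: "coEL_shellable (coset_lattice G)"
proof -
  have "finite_bounded_poset (coset_lattice G)"
    unfolding coset_lattice_eq
  proof unfold_locales
    show "\<exists>b. least (inclusion_order (insert {} (Collect coset))) b
        (carrier (inclusion_order (insert {} (Collect coset))))"
      by (rule exI[of _ "{}"]) (simp add: least_def Lower_def)
    show "\<exists>b. greatest (inclusion_order (insert {} (Collect coset))) b
        (carrier (inclusion_order (insert {} (Collect coset))))"
      using lattice.ends(1) coset_subset
      by (intro exI[of _ "carrier G"]) (auto simp: greatest_def Upper_def)
  qed (use lattice.finite_L in auto)
  moreover have "coEL_labeling (coset_lattice G) label"
    using lattice.EL_labeling_greedy by (simp add: coEL_labeling_def coset_lattice_eq)
  ultimately show ?thesis by (auto simp: coEL_shellable_def)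
qed

text \<open>The order complex depends only on comparability, so inclusion and its reverse have the
  same one.\<close>

theorem shellable_coset_poset: "coset_shellable G"
proof -
  have "order_complex (coset_poset G) =
      order_complex (lattice.poset (insert {} (Collect coset) - {carrier G, {}}))"
    by (auto simp: order_complex_def coset_poset_def proper_cosets_eq pred_on.chain_def)
  then show ?thesis
    using lattice.shellable_proper_part by (simp add: coset_shellable_def shellable_def)
qed

end

text \<open>Each factor of the chief series is complemented separately, with a Sylow subgroup for
  its own prime; the complements are then collected into the family \<open>A\<close>.\<close>

lemma (in group) supersolvable_complemented_series:
  assumes fin: "finite (carrier G)" and "supersolvable G"
    and elementary: "\<And>p H. sylow_subgroup p H G \<Longrightarrow> elementary_abelian p (G\<lparr>carrier := H\<rparr>)"
  shows "\<exists>N A r. complemented_series G N A r"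
proof -
  obtain Ns where Ns: "chief_series G Ns"
    and prime: "\<And>i. Suc i < length Ns \<Longrightarrow>
      prime (order ((G\<lparr>carrier := Ns ! Suc i\<rparr>) Mod (Ns ! i)))"
    using \<open>supersolvable G\<close> unfolding supersolvable_def by blast
  define r where "r = length Ns - 1"
  have len: "length Ns = Suc r"
    using Ns by (cases Ns) (auto simp: r_def chief_series_def)
  have normal: "Ns ! i \<lhd> G" if "i \<le> r" for i
    using Ns that nth_mem[of i Ns] len by (auto simp: chief_series_def)
  have sub: "Ns ! i \<subseteq> Ns ! Suc i" if "i < r" for i
    using Ns that len by (auto simp: chief_series_def)
  have factor: "\<exists>p. prime p \<and> card (Ns ! Suc i) = p * card (Ns ! i)" if i: "i < r" for i
  proof -
    let ?H = "G\<lparr>carrier := Ns ! Suc i\<rparr>"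
    have sg: "subgroup (Ns ! i) G" "subgroup (Ns ! Suc i) G"
      using normal[of i] normal[of "Suc i"] i by (simp_all add: normal_imp_subgroup)
    interpret H: group ?H
      using sg(2) by (rule subgroup_imp_group)
    have "subgroup (Ns ! i) ?H"
      using sg sub[OF i] by (intro subgroup_incl)
    from H.lagrange[OF this]
    have "card (Ns ! Suc i) = order (?H Mod (Ns ! i)) * card (Ns ! i)"
      by (simp add: order_def FactGroup_def)
    moreover have "prime (order (?H Mod (Ns ! i)))"
      using i len by (intro prime) simp
    ultimately show ?thesis by blast
  qed
  have "\<exists>A. subgroup A G \<and> Ns ! i \<subseteq> A \<and> A \<inter> Ns ! Suc i \<subseteq> Ns ! i \<and> Ns ! Suc i <#> A = carrier G"
    if i: "i < r" for i
  proof -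
    obtain p where p: "prime p" "card (Ns ! Suc i) = p * card (Ns ! i)"
      using factor[OF i] by blast
    obtain m where "order G = p ^ multiplicity p (order G) * m"
      using multiplicity_dvd by (rule dvdE)
    from sylow_thm[OF p(1) is_group this fin]
    obtain S where S: "subgroup S G" "card S = p ^ multiplicity p (order G)" by blast
    have "elementary_abelian p (G\<lparr>carrier := S\<rparr>)"
      using S p(1) by (intro elementary) (simp add: sylow_subgroup_def)
    then have "comm_group (G\<lparr>carrier := S\<rparr>)" and pow: "\<And>x. x \<in> S \<Longrightarrow> x [^] p = \<one>"
      by (simp_all add: elementary_abelian_def flip: nat_pow_consistent)
    then interpret S: comm_group "G\<lparr>carrier := S\<rparr>" by simp
    show ?thesis
      using S.m_comm pow normal sub[OF i] i
      by (intro prime_factor_complement[OF fin _ _ _ p S]) auto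
  qed
  then obtain A where A: "\<And>i. i < r \<Longrightarrow> subgroup (A i) G" "\<And>i. i < r \<Longrightarrow> Ns ! i \<subseteq> A i"
      "\<And>i. i < r \<Longrightarrow> A i \<inter> Ns ! Suc i \<subseteq> Ns ! i" "\<And>i. i < r \<Longrightarrow> Ns ! Suc i <#> A i = carrier G"
    by metis
  have "complemented_series G (\<lambda>i. Ns ! i) A r"
  proof (intro complemented_series.intro complemented_series_axioms.intro)
    show "Ns ! 0 = {\<one>}" "Ns ! r = carrier G"
      using Ns len by (auto simp: chief_series_def hd_conv_nth last_conv_nth)
  qed (fact is_group fin normal sub factor A)+
  then show ?thesis by blast
qed

theorem theorem4p5:
  fixes G :: "('a, 'b) monoid_scheme"
  assumes "group G" and "finite (carrier G)" and "supersolvable G"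
    and "\<And>p H. sylow_subgroup p H G \<Longrightarrow> elementary_abelian p (G\<lparr>carrier := H\<rparr>)"
  shows "coEL_shellable (coset_lattice G) \<and> coset_shellable G"
proof -
  obtain N A r where "complemented_series G N A r"
    using group.supersolvable_complemented_series[OF assms] by blast
  then interpret complemented_series G N A r .
  show ?thesis
    using coEL_shellable_coset_lattice shellable_coset_poset by blast
qed

end
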